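(* Let $k$ be a field, $P$ a finite connected poset, $T\in\mathrm{Int}(P)$ and $C\in\mathcal U(T)$ with $C\ne T$. There is a homotopy equivalence $$\mathcal N_T^-(C)\simeq\begin{cases}\partial\mathrm{Simp}(\mathrm{Min}(T\setminus C))\simeq\mathbb S^{\omega^-(T,C)-2},&(T,C)\in\Upsilon^-(P),\\\mathrm{pt},&(T,C)\notin\Upsilon^-(P).\end{cases}$$ Consequently, for every $r\in\mathbb Z$, $$\widetilde H^r(\mathcal N_T^-(C);k)\cong\begin{cases}\det(\mathrm{Min}(T\setminus C)),&(T,C)\in\Upsilon^-(P)\text{ and }r=\omega^-(T,C)-2,\\0,&\text{otherwise.}\end{cases}$$
   Context: A subset $S\subseteq P$ is connected if any $x,y\in S$ are joined by a sequence $x=x_0,\dots,x_r=y$ in $S$ with $x_{i-1},x_i$ comparable for all $i$; convex if $x,y\in S$ and $x\le z\le y$ imply $z\in S$; an interval if it is nonempty, connected and convex. $\mathrm{Int}(P)$ is the set of intervals of $P$. For an interval $T$, a subset $C\subseteq T$ is a relative upset in $T$ if $c\in C$, $x\in T$, $c\le x$ imply $x\in C$. $\mathcal U(T)$ is the set of intervals contained in $T$ that are relative upsets in $T$. $\mathrm{Min}(X)$ is the set of minimal elements of $X$. For $C\in\mathcal U(T)$, the lower boundary is $\partial_T^-C=\{x\in T\setminus C\mid x\lessdot_Tc\text{ for some }c\in C\}$, where $\lessdot_T$ is the covering relation in $T$ (so $\partial_T^-T=\varnothing$). $C$ has extremal lower boundary in $T$ if $\partial_T^-C=\mathrm{Min}(T\setminus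 C)$; then $\omega^-(T,C):=|\partial_T^-C|=|\mathrm{Min}(T\setminus C)|$. $\Upsilon^-(P)$ is the set of all pairs $(T,C)$ with $T\in\mathrm{Int}(P)$, $C\in\mathcal U(T)$ and $C$ having extremal lower boundary in $T$. Let $U_1,\dots,U_m$ be the inclusion-maximal elements of $\mathcal U(T)\setminus\{T\}$. For $C\in\mathcal U(T)$, $C\neq T$, put $I_T(C)=\{i\mid C\subseteq U_i\}$ and define the simplicial complex $\mathcal N_T^-(C)=\{F\subseteq\partial_T^-C\mid F\subseteq U_i\text{ for some }i\in I_T(C)\}$. For a finite set $X$: $\mathrm{Simp}(X)=\{F\mid F\subseteq X\}$, $\partial\mathrm{Simp}(X)=\{F\mid F\subsetneq X\}$, and $\det(X)=\bigwedge^{|X|}k^X$, a one-dimensional $k$-vector space (top exterior power of the free $k$-vector space on $X$). Conventions: simplicial complexes contain the empty face; the complex $\{\varnothing\}$ has empty realization, identified with $\mathbb S^{-1}$, and $\widetilde H^{-1}(\{\varnothing\};k)=k$. *)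

theory Defs
  imports "HOL-Analysis.Analysis" "HOL-Library.Function_Algebras"
begin

section \<open>Posets and intervals\<close>

text \<open>A poset is a subset \<open>P\<close> of a type of class \<^class>\<open>order\<close>, with the induced order.\<close>

definition poset_connected :: "'a::order set \<Rightarrow> bool" where
  "poset_connected S \<longleftrightarrow>
     (\<forall>x\<in>S. \<forall>y\<in>S. (x, y) \<in> {(a, b). a \<in> S \<and> b \<in> S \<and> (a \<le> b \<or> b \<le> a)}\<^sup>*)"

definition poset_convex :: "'a::order set \<Rightarrow> 'a set \<Rightarrow> bool" where
  "poset_convex P S \<longleftrightarrow> (\<forall>x\<in>S. \<forall>y\<in>S. \<forall>z\<in>P. x \<le> z \<and> z \<le> y \<longrightarrow> z \<in> S)"

definition Intervals :: "'a::order set \<Rightarrow> 'a set set" where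
  "Intervals P = {S. S \<subseteq> P \<and> S \<noteq> {} \<and> poset_connected S \<and> poset_convex P S}"

definition relative_upset :: "'a::order set \<Rightarrow> 'a set \<Rightarrow> bool" where
  "relative_upset T C \<longleftrightarrow> C \<subseteq> T \<and> (\<forall>c\<in>C. \<forall>x\<in>T. c \<le> x \<longrightarrow> x \<in> C)"

definition upset_intervals :: "'a::order set \<Rightarrow> 'a set \<Rightarrow> 'a set set" where
  "upset_intervals P T = {C \<in> Intervals P. C \<subseteq> T \<and> relative_upset T C}"

definition minimals :: "'a::order set \<Rightarrow> 'a set" where
  "minimals X = {x \<in> X. \<forall>y\<in>X. y \<le> x \<longrightarrow> y = x}"

definition covered_in :: "'a::order set \<Rightarrow> 'a \<Rightarrow> 'a \<Rightarrow> bool" where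
  "covered_in T x c \<longleftrightarrow> x \<in> T \<and> c \<in> T \<and> x < c \<and> \<not> (\<exists>z\<in>T. x < z \<and> z < c)"

definition lower_boundary :: "'a::order set \<Rightarrow> 'a set \<Rightarrow> 'a set" where
  "lower_boundary T C = {x \<in> T - C. \<exists>c\<in>C. covered_in T x c}"

definition extremal_lower_boundary :: "'a::order set \<Rightarrow> 'a set \<Rightarrow> bool" where
  "extremal_lower_boundary T C \<longleftrightarrow> lower_boundary T C = minimals (T - C)"

text \<open>The number \<open>\<omega>\<^sup>-(T, C)\<close>; it is only meaningful if \<open>C\<close> has extremal lower boundary in \<open>T\<close>.\<close>

definition omega_minus :: "'a::order set \<Rightarrow> 'a set \<Rightarrow> nat" where
  "omega_minus T C = card (lower_boundary T C)"

definition Upsilon_minus :: "'a::order set \<Rightarrow> ('a set \<times> 'a set) set" where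
  "Upsilon_minus P =
     {(T, C). T \<in> Intervals P \<and> C \<in> upset_intervals P T \<and> extremal_lower_boundary T C}"

text \<open>The sets \<open>U\<^sub>1, \<dots>, U\<^sub>m\<close>. They serve as their own indices below, so that
  \<open>i \<in> I\<^sub>T(C)\<close> becomes \<open>U \<in> maximal_upset_intervals P T\<close> with \<open>C \<subseteq> U\<close>.\<close>

definition maximal_upset_intervals :: "'a::order set \<Rightarrow> 'a set \<Rightarrow> 'a set set" where
  "maximal_upset_intervals P T =
     {U \<in> upset_intervals P T - {T}. \<forall>V \<in> upset_intervals P T - {T}. U \<subseteq> V \<longrightarrow> V = U}"

definition N_minus :: "'a::order set \<Rightarrow> 'a set \<Rightarrow> 'a set \<Rightarrow> 'a set set" where
  "N_minus P T C =
     {F. F \<subseteq> lower_boundary T C \<and> (\<exists>U \<in> maximal_upset_intervals P T. C \<subseteq> U \<and> F \<subseteq> U)}"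


section \<open>Simplicial complexes and their realizations\<close>

text \<open>An abstract simplicial complex is its set of faces, including the empty face.\<close>

definition boundary_simp :: "'a set \<Rightarrow> 'a set set" where
  "boundary_simp X = {F. F \<subset> X}"

text \<open>Points are given by barycentric coordinates. The product topology is the usual topology
  of the realization as long as the vertex set is finite. A face is the support of a point in its
  relative interior; as the coordinates add up to 1, the empty face contributes no point.\<close>

definition realization :: "'a set set \<Rightarrow> ('a \<Rightarrow> real) topology" where
  "realization K = subtopology (powertop_real UNIV)
     {f. (\<forall>v. 0 \<le> f v) \<and> {v. f v \<noteq> 0} \<in> K \<and> (\<Sum>v | f v \<noteq> 0. f v) = 1}"

text \<open>The sphere of dimension \<open>n \<ge> -1\<close>, where the sphere of dimension \<open>-1\<close> is empty.\<close>

definition int_sphere :: "int \<Rightarrow> (nat \<Rightarrow> real) topology" where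
  "int_sphere n = (if n < 0 then trivial_topology else nsphere (nat n))"

definition point_space :: "unit topology" where
  "point_space = discrete_topology UNIV"


section \<open>Vector spaces\<close>

text \<open>A vector space with explicit carrier and operations, needed since quotients of subspaces are
  not types.\<close>

record ('k, 'v) vspace =
  vs_carrier :: "'v set"
  vs_add :: "'v \<Rightarrow> 'v \<Rightarrow> 'v"
  vs_scale :: "'k \<Rightarrow> 'v \<Rightarrow> 'v"

definition vs_iso :: "('k, 'v) vspace \<Rightarrow> ('k, 'w) vspace \<Rightarrow> bool" where
  "vs_iso V W \<longleftrightarrow> (\<exists>f. bij_betw f (vs_carrier V) (vs_carrier W) \<and>
     (\<forall>x \<in> vs_carrier V. \<forall>y \<in> vs_carrier V. f (vs_add V x y) = vs_add W (f x) (f y)) \<and>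
     (\<forall>a. \<forall>x \<in> vs_carrier V. f (vs_scale V a x) = vs_scale W a (f x)))"

definition zero_vspace :: "('k, unit) vspace" where
  "zero_vspace = \<lparr>vs_carrier = UNIV, vs_add = (\<lambda>_ _. ()), vs_scale = (\<lambda>_ _. ())\<rparr>"

definition fun_scale :: "'k::field \<Rightarrow> ('b \<Rightarrow> 'k) \<Rightarrow> 'b \<Rightarrow> 'k" where
  "fun_scale a f = (\<lambda>x. a * f x)"

text \<open>The quotient \<open>V / W\<close>, for subspaces \<open>W \<subseteq> V\<close> of a space of functions. Adding \<open>W\<close> in the scalar
  multiplication only matters for the scalar 0.\<close>

definition quotient_vspace ::
    "('b \<Rightarrow> 'k::field) set \<Rightarrow> ('b \<Rightarrow> 'k) set \<Rightarrow> ('k, ('b \<Rightarrow> 'k) set) vspace" where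
  "quotient_vspace V W =
     \<lparr>vs_carrier = {{v + w | w. w \<in> W} | v. v \<in> V},
      vs_add = (\<lambda>A B. {a + b | a b. a \<in> A \<and> b \<in> B}),
      vs_scale = (\<lambda>c A. {fun_scale c a + w | a w. a \<in> A \<and> w \<in> W})\<rparr>"


section \<open>Reduced simplicial cohomology\<close>

text \<open>An \<open>r\<close>-cochain is an alternating function on the ordered \<open>r\<close>-simplices, i.e. the lists of
  \<open>r + 1\<close> distinct vertices spanning a face, extended by 0 to all other lists. The empty face
  makes the only (-1)-simplex, and there are no nonzero cochains in degrees below -1.\<close>

definition cochains :: "'a set set \<Rightarrow> int \<Rightarrow> ('a list \<Rightarrow> 'k::field) set" where
  "cochains K r = {c.
     (\<forall>xs. c xs \<noteq> 0 \<longrightarrow> distinct xs \<and> set xs \<in> K \<and> int (length xs) = r + 1) \<and>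
     (\<forall>xs i j. i < j \<and> j < length xs \<longrightarrow> c (xs[i := xs ! j, j := xs ! i]) = - c xs)}"

definition coboundary :: "'a set set \<Rightarrow> ('a list \<Rightarrow> 'k::field) \<Rightarrow> 'a list \<Rightarrow> 'k" where
  "coboundary K c = (\<lambda>xs. if distinct xs \<and> set xs \<in> K
     then \<Sum>i<length xs. (-1) ^ i * c (take i xs @ drop (Suc i) xs) else 0)"

definition cocycles :: "'a set set \<Rightarrow> int \<Rightarrow> ('a list \<Rightarrow> 'k::field) set" where
  "cocycles K r = {c \<in> cochains K r. coboundary K c = 0}"

definition coboundaries :: "'a set set \<Rightarrow> int \<Rightarrow> ('a list \<Rightarrow> 'k::field) set" where
  "coboundaries K r = coboundary K ` cochains K (r - 1)"

definition reduced_cohomology ::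
    "'k::field itself \<Rightarrow> 'a set set \<Rightarrow> int \<Rightarrow> ('k, ('a list \<Rightarrow> 'k) set) vspace" where
  "reduced_cohomology k K r = quotient_vspace (cocycles K r) (coboundaries K r)"


section \<open>Exterior powers\<close>

text \<open>The \<open>n\<close>-th exterior power of a subspace \<open>V\<close> of a space of functions is the quotient of the free
  vector space on \<open>n\<close>-tuples (lists of length \<open>n\<close>) of elements of \<open>V\<close> by the subspace making the
  map that sends a tuple to its class multilinear and alternating. The free vector space consists
  of finitely supported functions on tuples.\<close>

definition single :: "'b \<Rightarrow> 'b \<Rightarrow> 'k::field" where
  "single x = (\<lambda>y. if y = x then 1 else 0)"

definition tuples :: "nat \<Rightarrow> 'v set \<Rightarrow> 'v list set" where
  "tuples n V = {xs. length xs = n \<and> set xs \<subseteq> V}"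

definition alternating_relations :: "nat \<Rightarrow> ('b \<Rightarrow> 'k::field) set \<Rightarrow> (('b \<Rightarrow> 'k) list \<Rightarrow> 'k) set" where
  "alternating_relations n V =
     {single (xs[i := u + v]) - single (xs[i := u]) - single (xs[i := v]) | xs i u v.
        xs \<in> tuples n V \<and> i < n \<and> u \<in> V \<and> v \<in> V} \<union>
     {single (xs[i := fun_scale a u]) - fun_scale a (single (xs[i := u])) | xs i a u.
        xs \<in> tuples n V \<and> i < n \<and> u \<in> V} \<union>
     {single xs | xs. xs \<in> tuples n V \<and> (\<exists>i j. i < j \<and> j < n \<and> xs ! i = xs ! j)}"

definition exterior_power ::
    "nat \<Rightarrow> ('b \<Rightarrow> 'k::field) set \<Rightarrow> ('k, (('b \<Rightarrow> 'k) list \<Rightarrow> 'k) set) vspace" where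
  "exterior_power n V = quotient_vspace
     (module.span fun_scale (single ` tuples n V))
     (module.span fun_scale (alternating_relations n V))"

text \<open>The space \<open>k\<^sup>X\<close>, as the space of functions vanishing outside \<open>X\<close>.\<close>

definition free_vspace :: "'k::field itself \<Rightarrow> 'a set \<Rightarrow> ('a \<Rightarrow> 'k) set" where
  "free_vspace k X = {f. \<forall>x. x \<notin> X \<longrightarrow> f x = 0}"

definition det_space ::
    "'k::field itself \<Rightarrow> 'a set \<Rightarrow> ('k, (('a \<Rightarrow> 'k) list \<Rightarrow> 'k) set) vspace" where
  "det_space k X = exterior_power (card X) (free_vspace k X)"

end

theory Submission
  imports Defs
begin

text \<open>The complement of a maximal proper upset interval \<open>U \<supseteq> C\<close> has a least element \<open>a\<close>, and
  \<open>U\<close> meets the lower boundary of \<open>C\<close> in the complement of \<open>a\<close>. If the lower boundary is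
  extremal, every boundary vertex occurs as such an \<open>a\<close>: for \<open>b\<close> in the boundary, \<open>C\<close> together
  with everything above the other boundary vertices is an upset interval missing \<open>b\<close>, while no
  proper upset contains all of \<open>Min(T - C)\<close>; hence the complex is the boundary of a simplex.
  Otherwise some boundary vertex is not omitted by any \<open>U\<close>, and the complex is a cone over it.

  Cohomology is computed with the operator that prepends a vertex \<open>v\<close> to a simplex. It contracts
  the cochain complex in every degree whose faces stay faces when \<open>v\<close> is added; for the boundary
  of a simplex on \<open>n\<close> vertices this leaves only degree \<open>n - 2\<close>, where evaluating the coboundary
  on the missing top face identifies cohomology with \<open>k\<close>. The determinant identifies the top
  exterior power with \<open>k\<close>.\<close>

section \<open>The complex of an upset interval\<close>

abbreviation comparability :: "'a::order set \<Rightarrow> ('a \<times> 'a) set" where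
  "comparability S \<equiv> {(a, b). a \<in> S \<and> b \<in> S \<and> (a \<le> b \<or> b \<le> a)}"

lemma sym_comparability_rtrancl: "(x, y) \<in> (comparability S)\<^sup>* \<Longrightarrow> (y, x) \<in> (comparability S)\<^sup>*"
proof -
  have "sym ((comparability S)\<^sup>*)"
    by (rule sym_rtrancl) (auto simp: sym_def)
  then show "(x, y) \<in> (comparability S)\<^sup>* \<Longrightarrow> (y, x) \<in> (comparability S)\<^sup>*"
    by (rule symD)
qed

text \<open>Two points of \<open>W\<close> are joined by going from the first into \<open>C\<close>,
  crossing \<open>C\<close>, and leaving along a reversed path to the second.\<close>

lemma poset_connected_extend:
  assumes C: "poset_connected C" "C \<subseteq> W"
    and step: "\<And>w. w \<in> W \<Longrightarrow> \<exists>c\<in>C. (w, c) \<in> (comparability W)\<^sup>*"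
  shows "poset_connected W"
  unfolding poset_connected_def
proof (intro ballI)
  fix x y assume "x \<in> W" "y \<in> W"
  then obtain c d where c: "c \<in> C" "(x, c) \<in> (comparability W)\<^sup>*" and d: "d \<in> C" "(y, d) \<in> (comparability W)\<^sup>*"
    using step by meson
  have "(c, d) \<in> (comparability C)\<^sup>*"
    using C c d by (auto simp: poset_connected_def)
  then have "(c, d) \<in> (comparability W)\<^sup>*"
    by (rule rtrancl_mono[THEN subsetD, rotated]) (use C in auto)
  then show "(x, y) \<in> (comparability W)\<^sup>*"
    using c(2) sym_comparability_rtrancl[OF d(2)] by (meson rtrancl_trans)
qed

text \<open>Convexity is inherited from \<open>T\<close>: a point of \<open>P\<close> between two
  points of \<open>C\<close> lies in \<open>T\<close>, and being above a point of \<open>C\<close>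
  it lies in \<open>C\<close>. From here on, producing an upset interval comes down to connectedness
  and upward closure.\<close>

lemma upset_interval_iff:
  assumes "T \<in> Intervals P"
  shows "C \<in> upset_intervals P T \<longleftrightarrow> C \<noteq> {} \<and> poset_connected C \<and> relative_upset T C"
proof
  assume R: "C \<noteq> {} \<and> poset_connected C \<and> relative_upset T C"
  then have "poset_convex P C"
    unfolding poset_convex_def
  proof (intro ballI impI)
    fix x y z assume *: "x \<in> C" "y \<in> C" "z \<in> P" "x \<le> z \<and> z \<le> y"
    then have "z \<in> T"
      using assms R by (auto simp: Intervals_def poset_convex_def relative_upset_def)
    then show "z \<in> C"
      using * R by (auto simp: relative_upset_def)
  qed
  then show "C \<in> upset_intervals P T"
    using R assms by (auto simp: upset_intervals_def Intervals_def relative_upset_def)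
qed (simp add: upset_intervals_def Intervals_def)

text \<open>A new point \<open>w\<close> lies above some \<open>y\<close> in \<open>Y\<close>, which
  in turn lies below some \<open>c\<close> in \<open>C\<close>, so the path \<open>w\<close>,
  \<open>y\<close>, \<open>c\<close> ties it to \<open>C\<close>. All larger upset intervals below
  arise this way, with \<open>Y\<close> a single point, the lower boundary, or the boundary without
  one vertex.\<close>

lemma upset_interval_generated:
  assumes T: "T \<in> Intervals P" and C: "C \<in> upset_intervals P T"
    and Y: "\<And>y. y \<in> Y \<Longrightarrow> y \<in> T \<and> (\<exists>c\<in>C. y \<le> c)"
  shows "C \<union> {x \<in> T. \<exists>y\<in>Y. y \<le> x} \<in> upset_intervals P T" (is "?W \<in> _")
proof -
  have C': "C \<noteq> {}" "poset_connected C" "relative_upset T C"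
    using C upset_interval_iff[OF T] by auto
  have "poset_connected ?W"
  proof (rule poset_connected_extend[OF C'(2)])
    fix w assume w: "w \<in> ?W"
    show "\<exists>c\<in>C. (w, c) \<in> (comparability ?W)\<^sup>*"
    proof (cases "w \<in> C")
      case False
      then obtain y c where y: "y \<in> Y" "y \<le> w" "c \<in> C" "y \<le> c" "y \<in> T" using w Y by blast
      then have "(w, y) \<in> comparability ?W" "(y, c) \<in> comparability ?W" using w by auto
      then show ?thesis using y(3) by (meson converse_rtrancl_into_rtrancl r_into_rtrancl)
    qed auto
  qed auto
  moreover have "relative_upset T ?W"
    using C'(3) unfolding relative_upset_def by (blast intro: order_trans)
  ultimately show ?thesis
    using C'(1) upset_interval_iff[OF T] by auto
qed

text \<open>Adjoining to \<open>U\<close> everything above \<open>x\<close> gives a strictly larger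
  upset interval, which by maximality is \<open>T\<close>. Hence the rest of the complement lies
  above \<open>x\<close>.\<close>

lemma maximal_upset_complement_least:
  assumes T: "T \<in> Intervals P" and U: "U \<in> maximal_upset_intervals P T"
    and x: "x \<in> T - U" "c \<in> U" "x \<le> c" and z: "z \<in> T - U"
  shows "x \<le> z"
proof -
  have U': "U \<in> upset_intervals P T" and
    max: "\<And>V. V \<in> upset_intervals P T \<Longrightarrow> V \<noteq> T \<Longrightarrow> U \<subseteq> V \<Longrightarrow> V = U"
    using U by (auto simp: maximal_upset_intervals_def)
  have "U \<union> {w \<in> T. \<exists>y\<in>{x}. y \<le> w} \<in> upset_intervals P T"
    by (rule upset_interval_generated[OF T U']) (use x in auto)
  with max[OF this] have "U \<union> {w \<in> T. \<exists>y\<in>{x}. y \<le> w} = T"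
    using x by blast
  then show ?thesis using z by auto
qed

text \<open>A path in \<open>T\<close> from outside \<open>C\<close> into \<open>C\<close> contains
  a comparable pair across the border, and between the two members of this pair there is a covering
  pair across the border.\<close>

lemma lower_boundary_nonempty:
  assumes "finite T" "poset_connected T" "relative_upset T C" "C \<noteq> {}" "C \<noteq> T"
  shows "lower_boundary T C \<noteq> {}"
proof -
  have CT: "C \<subseteq> T" and up: "\<And>c x. c \<in> C \<Longrightarrow> x \<in> T \<Longrightarrow> c \<le> x \<Longrightarrow> x \<in> C"
    using assms(3) by (auto simp: relative_upset_def)
  obtain a b where ab: "a \<in> T" "a \<notin> C" "b \<in> C" using CT assms(4,5) by auto
  have "(a, b) \<in> (comparability T)\<^sup>*"
    using assms(2) ab CT by (auto simp: poset_connected_def)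
  \<comment> \<open>The path has to enter \<open>C\<close> somewhere. As \<open>C\<close> is an
    upset, the entering step goes upwards.\<close>
  then have "a \<notin> C \<longrightarrow> (\<exists>x\<in>T - C. \<exists>c\<in>C. x \<le> c)"
    by (induction rule: converse_rtrancl_induct) (use ab up in auto)
  then obtain x c where xc: "x \<in> T - C" "c \<in> C" "x \<le> c" using ab by auto
  \<comment> \<open>First \<open>z\<close> is taken maximal outside \<open>C\<close> below
    \<open>c\<close>, then \<open>d\<close> minimal in \<open>C\<close> between \<open>z\<close> and
    \<open>c\<close>. A point strictly between \<open>z\<close> and \<open>d\<close> would
    contradict the choice of \<open>d\<close> if it lies in \<open>C\<close>, and that of
    \<open>z\<close> otherwise.\<close>
  define Z where "Z = {z \<in> T - C. z \<le> c}"
  have Z: "finite Z" "x \<in> Z" using xc assms(1) by (auto simp: Z_def)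
  obtain z where z: "z \<in> Z" "\<And>y. y \<in> Z \<Longrightarrow> z \<le> y \<Longrightarrow> z = y"
    using finite_has_maximal2[OF Z] by metis
  define D where "D = {d \<in> C. z < d \<and> d \<le> c}"
  have "z < c" using z(1) xc by (auto simp: Z_def order_less_le)
  then have D: "finite D" "c \<in> D"
    using xc assms(1) CT by (auto simp: D_def intro: finite_subset)
  obtain d where d: "d \<in> D" "\<And>y. y \<in> D \<Longrightarrow> y \<le> d \<Longrightarrow> d = y"
    using finite_has_minimal2[OF D] by metis
  have "covered_in T z d"
    unfolding covered_in_def
  proof (intro conjI notI)
    assume "\<exists>t\<in>T. z < t \<and> t < d"
    then obtain t where t: "t \<in> T" "z < t" "t < d" by auto
    then have "t \<le> c" using d(1) by (auto simp: D_def)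
    show False
    proof (cases "t \<in> C")
      case True
      then have "t \<in> D" using t \<open>t \<le> c\<close> by (auto simp: D_def)
      then show False using d(2) t by (metis less_le)
    next
      case False
      then have "t \<in> Z" using t \<open>t \<le> c\<close> by (auto simp: Z_def)
      then show False using z(2) t by (metis less_le)
    qed
  qed (use z d CT in \<open>auto simp: Z_def D_def\<close>)
  then show ?thesis
    using z d by (auto simp: lower_boundary_def Z_def D_def)
qed

lemma ex_maximal_upset_interval:
  assumes "finite T" "W \<in> upset_intervals P T" "W \<noteq> T"
  shows "\<exists>U\<in>maximal_upset_intervals P T. W \<subseteq> U"
proof -
  have "finite (upset_intervals P T - {T})"
    by (rule finite_subset[of _ "Pow T"]) (use assms(1) in \<open>auto simp: upset_intervals_def\<close>)
  then obtain U where "U \<in> upset_intervals P T - {T}" "W \<subseteq> U"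
    "\<forall>V\<in>upset_intervals P T - {T}. U \<subseteq> V \<longrightarrow> U = V"
    using finite_has_maximal2[of "upset_intervals P T - {T}" W] assms(2,3) by blast
  then show ?thesis unfolding maximal_upset_intervals_def by blast
qed

lemma lower_boundaryD:
  "x \<in> lower_boundary T C \<Longrightarrow> x \<in> T \<and> x \<notin> C \<and> (\<exists>c\<in>C. x \<le> c)"
  unfolding lower_boundary_def covered_in_def by (simp add: order_less_le) blast

lemma maximal_upset_intervalD:
  "U \<in> maximal_upset_intervals P T \<Longrightarrow> U \<in> upset_intervals P T \<and> U \<noteq> T \<and> U \<subseteq> T"
  unfolding maximal_upset_intervals_def upset_intervals_def by blast

lemma exists_minimal_below:
  assumes "finite X" "x \<in> X"
  shows "\<exists>m\<in>minimals X. m \<le> x"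
proof -
  obtain m where "m \<in> X" "m \<le> x" "\<forall>y\<in>X. y \<le> m \<longrightarrow> m = y"
    using finite_has_minimal2[OF assms] by auto
  then show ?thesis by (auto simp: minimals_def)
qed

lemma N_minus_extremal:
  assumes fin: "finite T" and T: "T \<in> Intervals P" and C: "C \<in> upset_intervals P T"
    and ext: "extremal_lower_boundary T C"
  shows "N_minus P T C = boundary_simp (minimals (T - C))"
proof -
  let ?B = "minimals (T - C)"
  have B: "lower_boundary T C = ?B" using ext by (simp add: extremal_lower_boundary_def)
  have gen: "\<exists>m\<in>?B. m \<le> x" if "x \<in> T - C" for x
    using exists_minimal_below[of "T - C" x] fin that by auto
  show ?thesis
  proof (intro equalityI subsetI)
    fix F assume "F \<in> N_minus P T C"
    then obtain U where U: "F \<subseteq> ?B" "U \<in> maximal_upset_intervals P T" "C \<subseteq> U" "F \<subseteq> U"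
      by (auto simp: N_minus_def B)
    have "F \<noteq> ?B"
    proof
      assume "F = ?B"
      \<comment> \<open>Every point of \<open>T - C\<close> lies above a minimal one, so an upset
        containing \<open>C\<close> and \<open>?B\<close> is all of \<open>T\<close>.\<close>
      have "T \<subseteq> U"
      proof
        fix x assume "x \<in> T"
        then obtain m where "m \<in> U" "m \<le> x"
          using gen[of x] U \<open>F = ?B\<close> by (cases "x \<in> C") auto
        then show "x \<in> U"
          using maximal_upset_intervalD[OF U(2)] \<open>x \<in> T\<close>
          by (auto simp: upset_intervals_def relative_upset_def)
      qed
      then show False using maximal_upset_intervalD[OF U(2)] by auto
    qed
    then show "F \<in> boundary_simp ?B" using U by (auto simp: boundary_simp_def)
  next
    fix F assume "F \<in> boundary_simp ?B"
    then obtain x where F: "F \<subseteq> ?B - {x}" and x: "x \<in> ?B" by (auto simp: boundary_simp_def)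
    \<comment> \<open>This upset interval contains \<open>F\<close> but misses \<open>x\<close>,
      because no other element of \<open>?B\<close> lies below the minimal element
      \<open>x\<close>.\<close>
    define W where "W = C \<union> {w \<in> T. \<exists>y\<in>?B - {x}. y \<le> w}"
    have W: "W \<in> upset_intervals P T"
      unfolding W_def by (rule upset_interval_generated[OF T C]) (use lower_boundaryD[of _ T C] B in auto)
    have "x \<notin> W" using x by (auto simp: W_def minimals_def)
    then have "W \<noteq> T" using x by (auto simp: minimals_def)
    then obtain U where U: "U \<in> maximal_upset_intervals P T" "W \<subseteq> U"
      using ex_maximal_upset_interval[OF fin W] by auto
    have "F \<subseteq> W" using F unfolding W_def minimals_def by blast
    moreover have "C \<subseteq> W" by (simp add: W_def)
    ultimately show "F \<in> N_minus P T C"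
      using U F by (auto simp: N_minus_def B)
  qed
qed

text \<open>By contraposition: if no vertex is an apex, each boundary vertex is omitted by some
  \<open>U\<close> containing \<open>C\<close>, and this forces both inclusions between the lower
  boundary and the minimal elements of \<open>T - C\<close>.\<close>

lemma N_minus_cone:
  assumes fin: "finite T" and T: "T \<in> Intervals P" and C: "C \<in> upset_intervals P T" "C \<noteq> T"
    and ext: "\<not> extremal_lower_boundary T C"
  shows "\<exists>v. \<forall>F\<in>N_minus P T C. insert v F \<in> N_minus P T C"
proof (rule ccontr)
  assume "\<not> ?thesis"
  then have no_apex: "\<exists>F\<in>N_minus P T C. insert v F \<notin> N_minus P T C" for v by auto
  let ?B = "lower_boundary T C"
  have ne: "?B \<noteq> {}"
    using lower_boundary_nonempty[OF fin, of C] T C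
    by (auto simp: upset_intervals_def Intervals_def)
  \<comment> \<open>If every \<open>U\<close> containing \<open>C\<close> also contained
    \<open>v\<close>, then adding \<open>v\<close> to a face would leave it inside the same
    \<open>U\<close>, and \<open>v\<close> would be an apex.\<close>
  have omitted: "\<exists>U\<in>maximal_upset_intervals P T. C \<subseteq> U \<and> v \<notin> U" if "v \<in> ?B" for v
    using no_apex[of v] that by (auto simp: N_minus_def)
  have "?B \<subseteq> minimals (T - C)"
  proof
    fix v assume v: "v \<in> ?B"
    obtain U where U: "U \<in> maximal_upset_intervals P T" "C \<subseteq> U" "v \<notin> U"
      using omitted[OF v] by auto
    have "y = v" if y: "y \<in> T - C" "y \<le> v" for y
    proof -
      \<comment> \<open>\<open>U\<close> is an upset missing \<open>v\<close>, so it misses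
        everything below \<open>v\<close> too; and \<open>v\<close> is the least element of its
        complement.\<close>
      have "y \<notin> U"
        using y U(3) maximal_upset_intervalD[OF U(1)] lower_boundaryD[OF v]
        by (auto simp: upset_intervals_def relative_upset_def)
      then have "v \<le> y"
        using maximal_upset_complement_least[OF T U(1)] lower_boundaryD[OF v] U y by blast
      then show ?thesis using y by auto
    qed
    then show "v \<in> minimals (T - C)"
      using lower_boundaryD[OF v] by (auto simp: minimals_def)
  qed
  moreover have "minimals (T - C) \<subseteq> ?B"
  proof
    define W where "W = C \<union> {w \<in> T. \<exists>y\<in>?B. y \<le> w}"
    have W: "W \<in> upset_intervals P T"
      unfolding W_def by (rule upset_interval_generated[OF T C(1)]) (use lower_boundaryD[of _ T C] in auto)
    \<comment> \<open>Otherwise some \<open>U\<close> contains the whole lower boundary, and the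
      complex is a full simplex, with each of its vertices as apex.\<close>
    have "W = T"
    proof (rule ccontr)
      assume "W \<noteq> T"
      then obtain U where U: "U \<in> maximal_upset_intervals P T" "W \<subseteq> U"
        using ex_maximal_upset_interval[OF fin W] by auto
      have "C \<subseteq> W" by (simp add: W_def)
      moreover have "?B \<subseteq> W"
        using lower_boundaryD[of _ T C] by (auto simp: W_def)
      ultimately have "C \<subseteq> U" "?B \<subseteq> U" using U(2) by auto
      then have "N_minus P T C = Pow ?B" using U(1) unfolding N_minus_def by blast
      then show False using no_apex ne by auto
    qed
    fix z assume z: "z \<in> minimals (T - C)"
    then obtain y where "y \<in> ?B" "y \<le> z" using \<open>W = T\<close> by (auto simp: W_def minimals_def)
    then show "z \<in> ?B" using z lower_boundaryD[of y T C] by (auto simp: minimals_def)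
  qed
  ultimately show False using ext by (auto simp: extremal_lower_boundary_def)
qed

section \<open>Realizations of cones and of simplex boundaries\<close>

lemma continuous_map_Min:
  fixes g :: "'a \<Rightarrow> 'b \<Rightarrow> real"
  assumes "finite I" "I \<noteq> {}" "\<And>i. i \<in> I \<Longrightarrow> continuous_map X euclideanreal (\<lambda>x. g x i)"
  shows "continuous_map X euclideanreal (\<lambda>x. Min (g x ` I))"
  using assms by (induction rule: finite_ne_induct) (auto intro: continuous_map_real_min)

text \<open>Summing over the fixed set \<open>V\<close> instead of the varying support makes the
  last condition affine in \<open>f\<close>, as convex combinations require.\<close>

lemma topspace_realization:
  assumes "finite V" "K \<subseteq> Pow V"
  shows "topspace (realization K) =
    {f. (\<forall>v. 0 \<le> f v) \<and> {v. f v \<noteq> 0} \<in> K \<and> (\<Sum>v\<in>V. f v) = 1}"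
proof -
  have "(\<Sum>v | f v \<noteq> 0. f v) = (\<Sum>v\<in>V. f v)" if "{v. f v \<noteq> 0} \<in> K" for f :: "'a \<Rightarrow> real"
    by (rule sum.mono_neutral_left) (use that assms in auto)
  then show ?thesis
    by (auto simp: realization_def)
qed

lemma continuous_map_realization_coordinate:
  "continuous_map (realization K) euclideanreal (\<lambda>f. f v)"
  unfolding realization_def
  by (intro continuous_map_from_subtopology continuous_map_product_projection) simp

lemma continuous_map_into_realization:
  "continuous_map X (realization K) g \<longleftrightarrow>
    (\<forall>v. continuous_map X euclideanreal (\<lambda>x. g x v)) \<and> g \<in> topspace X \<rightarrow> topspace (realization K)"
  by (auto simp: realization_def continuous_map_in_subtopology continuous_map_componentwise_UNIV)

text \<open>The straight-line homotopy to the vertex \<open>v\<close> stays in the realization,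
  since it enlarges the support of a point by at most \<open>v\<close>.\<close>

lemma cone_realization_contractible:
  assumes fin: "finite V" and K: "K \<subseteq> Pow V" and ne: "K \<noteq> {}"
    and down: "\<And>F G. F \<in> K \<Longrightarrow> G \<subseteq> F \<Longrightarrow> G \<in> K"
    and apex: "\<And>F. F \<in> K \<Longrightarrow> insert v F \<in> K"
  shows "realization K homotopy_equivalent_space point_space"
proof -
  let ?X = "realization K"
  define p :: "'a \<Rightarrow> real" where "p = (\<lambda>w. if w = v then 1 else 0)"
  have vV: "v \<in> V" using ne apex K by blast
  have sum_p: "(\<Sum>w\<in>V. p w) = 1"
    using fin vV by (simp add: p_def)
  have line: "(\<lambda>w. (1 - t) * f w + t * p w) \<in> topspace ?X"
    if t: "0 \<le> t" "t \<le> 1" and f: "f \<in> topspace ?X" for t f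
  proof -
    have f': "\<And>w. 0 \<le> f w" "{w. f w \<noteq> 0} \<in> K" "(\<Sum>w\<in>V. f w) = 1"
      using f by (auto simp: topspace_realization[OF fin K])
    have "{w. (1 - t) * f w + t * p w \<noteq> 0} \<subseteq> insert v {w. f w \<noteq> 0}"
      by (auto simp: p_def)
    then have "{w. (1 - t) * f w + t * p w \<noteq> 0} \<in> K"
      using down apex f'(2) by blast
    moreover have "(\<Sum>w\<in>V. (1 - t) * f w + t * p w) = 1"
      by (simp add: sum.distrib f'(3) sum_p flip: sum_distrib_left)
    ultimately show ?thesis
      using f'(1) t by (auto simp: topspace_realization[OF fin K] p_def)
  qed
  obtain F where "F \<in> K" using ne by auto
  have "{w. p w \<noteq> 0} = {v}" by (auto simp: p_def)
  then have "{w. p w \<noteq> 0} \<in> K"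
    using down[OF apex[OF \<open>F \<in> K\<close>], of "{v}"] by simp
  then have p: "p \<in> topspace ?X"
    using sum_p by (simp add: topspace_realization[OF fin K]) (simp add: p_def)
  have "homotopic_with (\<lambda>_. True) ?X ?X id (\<lambda>_. p)"
  proof -
    let ?h = "\<lambda>(t, f) w. (1 - t) * f w + t * p w"
    have "continuous_map (prod_topology (top_of_set {0..1}) ?X) ?X ?h"
      unfolding continuous_map_into_realization case_prod_unfold
    proof (intro conjI allI)
      fix w
      have fst: "continuous_map (prod_topology (top_of_set {0..1}) ?X) euclideanreal fst"
        using continuous_map_fst continuous_map_into_fulltopology by blast
      have snd: "continuous_map (prod_topology (top_of_set {0..1}) ?X) euclideanreal (\<lambda>x. snd x w)"
        using continuous_map_compose[OF continuous_map_snd continuous_map_realization_coordinate]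
        by (simp add: o_def)
      show "continuous_map (prod_topology (top_of_set {0..1}) ?X) euclideanreal
              (\<lambda>x. (1 - fst x) * snd x w + fst x * p w)"
        by (intro continuous_intros fst snd) auto
    qed (auto intro: line)
    then show ?thesis
      unfolding homotopic_with_def by (intro exI[of _ ?h]) auto
  qed
  then have "homotopic_with (\<lambda>_. True) ?X ?X ((\<lambda>_. p) \<circ> (\<lambda>_. ())) id"
    by (simp add: o_def homotopic_with_symD)
  moreover have "homotopic_with (\<lambda>_. True) point_space point_space ((\<lambda>_. ()) \<circ> (\<lambda>_. p)) id"
    by (simp add: o_def id_def point_space_def)
  ultimately show ?thesis
    unfolding homotopy_equivalent_space_def using p
    by (intro exI[of _ "\<lambda>_. ()"] exI[of _ "\<lambda>_. p"]) (simp add: point_space_def)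
qed

section \<open>Simplex boundaries and spheres\<close>

lemma topspace_realization_boundary_simp:
  assumes "finite B"
  shows "topspace (realization (boundary_simp B)) =
    {f. (\<forall>v. 0 \<le> f v) \<and> (\<forall>v. v \<notin> B \<longrightarrow> f v = 0) \<and> (\<exists>v\<in>B. f v = 0) \<and> (\<Sum>v\<in>B. f v) = 1}"
proof -
  have "boundary_simp B \<subseteq> Pow B" by (auto simp: boundary_simp_def)
  then show ?thesis
    unfolding topspace_realization[OF assms \<open>boundary_simp B \<subseteq> Pow B\<close>]
    by (rule_tac Collect_cong) (auto simp: boundary_simp_def)
qed

text \<open>Centring identifies the boundary of the simplex with the unit vectors of the hyperplane of
  coordinate sum \<open>0\<close>, up to positive scaling; the inverse subtracts the minimal coordinate.
  The hyperplane in turn is parametrized by all coordinates but the one at \<open>b\<close>.\<close>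

lemma realization_boundary_simp_homeomorphic_nsphere:
  assumes fin: "finite B" and card: "card B = n + 2"
  shows "realization (boundary_simp B) homeomorphic_space nsphere n"
proof -
  let ?X = "realization (boundary_simp B)"
  \<comment> \<open>\<open>N\<close> is the number of vertices, so \<open>1 / N\<close> is each
    coordinate of the barycentre.\<close>
  define N :: real where "N = real n + 2"
  have N: "N > 0" by (simp add: N_def)
  have ne: "B \<noteq> {}" using card by auto
  then obtain b where b: "b \<in> B" by auto
  have "card {..n} = card (B - {b})" using fin card b by simp
  then obtain e where e: "bij_betw e {..n} (B - {b})"
    using finite_same_card_bij[of "{..n}" "B - {b}"] fin by auto
  define d where "d = inv_into {..n} e"
  have de: "d (e i) = i" if "i \<le> n" for i
    using e that by (simp add: d_def bij_betw_inv_into_left)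
  have ed: "e (d v) = v" "d v \<le> n" if "v \<in> B" "v \<noteq> b" for v
    using e that bij_betw_inv_into_right[OF e] bij_betwE[OF bij_betw_inv_into[OF e]]
    by (auto simp: d_def)
  have eB: "e i \<in> B" "e i \<noteq> b" if "i \<le> n" for i
    using e that by (auto simp: bij_betw_def)
  have sum_B: "(\<Sum>v\<in>B. g v) = g b + (\<Sum>i\<le>n. g (e i))" for g :: "'a \<Rightarrow> real"
    using sum.remove[OF fin b, of g] sum.reindex_bij_betw[OF e, of g] by simp
  \<comment> \<open>\<open>h x\<close> is the point of the hyperplane of coordinate sum 0 whose
    coordinates off \<open>b\<close> are the entries 0 to \<open>n\<close> of
    \<open>x\<close>.\<close>
  define h :: "(nat \<Rightarrow> real) \<Rightarrow> 'a \<Rightarrow> real"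
    where "h x v = (if v = b then - (\<Sum>i\<le>n. x i) else x (d v))" for x v
  define m where "m x = Min (h x ` B)" for x
  \<comment> \<open>The mass that is left once the minimum is subtracted. Dividing by it restores
    coordinate sum 1 and keeps the zero where the minimum was attained.\<close>
  define s where "s x = (\<Sum>v\<in>B. h x v - m x)" for x
  define \<psi> where "\<psi> x v = (if v \<in> B then (h x v - m x) / s x else 0)" for x v
  define r where "r f = sqrt (\<Sum>i\<le>n. (f (e i) - 1 / N)\<^sup>2)" for f :: "'a \<Rightarrow> real"
  define \<phi> where "\<phi> f i = (if i \<le> n then (f (e i) - 1 / N) / r f else 0)" for f i
  have sum_h: "(\<Sum>v\<in>B. h x v) = 0" for x
    by (simp add: sum_B) (simp add: h_def de eB)
  have s_eq: "s x = - N * m x" for x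
    by (simp add: s_def sum_subtractf sum_h card N_def algebra_simps)
  have m_le: "m x \<le> h x v" if "v \<in> B" for x v
    using that fin by (simp add: m_def)
  have m_in: "\<exists>v\<in>B. h x v = m x" for x
    using Min_in[of "h x ` B"] fin ne unfolding m_def by (metis finite_imageI imageE image_is_empty)
  have S: "topspace (nsphere n) = {x. (\<Sum>i\<le>n. x i ^ 2) = 1 \<and> (\<forall>i>n. x i = 0)}"
    by (simp add: nsphere)
  \<comment> \<open>If no coordinate of a vector of sum 0 is negative, all of them vanish; but a
    unit vector is not zero.\<close>
  have m_neg: "m x < 0" if x: "x \<in> topspace (nsphere n)" for x
  proof (rule ccontr)
    assume "\<not> m x < 0"
    then have "\<forall>v\<in>B. 0 \<le> h x v" using m_le[of _ x] by force
    then have "\<forall>v\<in>B. h x v = 0"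
      using sum_nonneg_eq_0_iff[OF fin, of "h x"] sum_h[of x] by auto
    then have "x i = 0" if "i \<le> n" for i
      using eB[OF that] de[OF that] by (metis h_def)
    then show False using x by (simp add: S)
  qed
  \<comment> \<open>The radius vanishes only at the barycentre, and a point of the boundary has some
    coordinate 0.\<close>
  have r_pos: "0 < r f" if f: "f \<in> topspace ?X" for f
  proof (rule ccontr)
    have nonneg: "0 \<le> (\<Sum>i\<le>n. (f (e i) - 1 / N)\<^sup>2)" by (simp add: sum_nonneg)
    assume "\<not> 0 < r f"
    then have "(\<Sum>i\<le>n. (f (e i) - 1 / N)\<^sup>2) = 0"
      using nonneg by (auto simp: r_def)
    then have fe: "f (e i) = 1 / N" if "i \<le> n" for i
      using that by (simp add: sum_nonneg_eq_0_iff)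
    moreover have "f b = 1 / N"
    proof -
      have "(\<Sum>v\<in>B. f v) = f b + (real n + 1) / N" by (simp add: sum_B fe)
      then have "f b = 1 - (real n + 1) / N"
        using f by (simp add: topspace_realization_boundary_simp[OF fin])
      then show ?thesis using N by (simp add: field_simps N_def)
    qed
    ultimately have "f v = 1 / N" if "v \<in> B" for v
      using ed that by metis
    then show False
      using f N by (auto simp: topspace_realization_boundary_simp[OF fin])
  qed
  have cont_h: "continuous_map (nsphere n) euclideanreal (\<lambda>x. h x v)" for v
    unfolding h_def by (cases "v = b") (auto intro!: continuous_intros continuous_map_nsphere_projection)
  have cont_m: "continuous_map (nsphere n) euclideanreal m"
    unfolding m_def using continuous_map_Min[OF fin ne cont_h] by simp
  have \<psi>_X: "\<psi> x \<in> topspace ?X" if x: "x \<in> topspace (nsphere n)" for x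
  proof -
    have s: "s x > 0" using m_neg[OF x] N by (simp add: s_eq mult_pos_neg)
    have "(\<Sum>v\<in>B. \<psi> x v) = (\<Sum>v\<in>B. (h x v - m x) / s x)"
      by (simp add: \<psi>_def)
    also have "\<dots> = s x / s x" by (simp only: s_def sum_divide_distrib)
    finally have "(\<Sum>v\<in>B. \<psi> x v) = 1" using s by simp
    then show ?thesis
      using s m_in[of x] m_le[of _ x]
      by (auto simp: topspace_realization_boundary_simp[OF fin] \<psi>_def)
  qed
  have cont_\<psi>: "continuous_map (nsphere n) ?X \<psi>"
    unfolding continuous_map_into_realization
  proof (intro conjI allI)
    fix v
    have "continuous_map (nsphere n) euclideanreal s"
      unfolding s_def by (intro continuous_intros cont_h cont_m fin)
    moreover have "s x \<noteq> 0" if "x \<in> topspace (nsphere n)" for x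
      using m_neg[OF that] N by (simp add: s_eq)
    ultimately show "continuous_map (nsphere n) euclideanreal (\<lambda>x. \<psi> x v)"
      unfolding \<psi>_def
      by (cases "v \<in> B") (auto intro!: continuous_intros cont_h cont_m)
  qed (use \<psi>_X in auto)
  have cont_\<phi>: "continuous_map ?X (nsphere n) \<phi>"
    unfolding nsphere continuous_map_in_subtopology continuous_map_componentwise_UNIV
  proof (intro conjI allI)
    fix i
    have "continuous_map ?X euclideanreal r"
      unfolding r_def by (intro continuous_intros continuous_map_realization_coordinate) auto
    then show "continuous_map ?X euclideanreal (\<lambda>f. \<phi> f i)"
      unfolding \<phi>_def using r_pos
      by (cases "i \<le> n") (force intro!: continuous_intros continuous_map_realization_coordinate)+
  next
    have "(\<Sum>i\<le>n. (\<phi> f i)\<^sup>2) = 1" if f: "f \<in> topspace ?X" for f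
    proof -
      have "(\<Sum>i\<le>n. (\<phi> f i)\<^sup>2) = (\<Sum>i\<le>n. (f (e i) - 1 / N)\<^sup>2) / (r f)\<^sup>2"
        by (simp add: \<phi>_def power_divide sum_divide_distrib)
      also have "(r f)\<^sup>2 = (\<Sum>i\<le>n. (f (e i) - 1 / N)\<^sup>2)"
        by (simp add: r_def sum_nonneg)
      finally show ?thesis using r_pos[OF f] by (auto simp: r_def)
    qed
    then show "\<phi> \<in> topspace ?X \<rightarrow> {x. (\<Sum>i\<le>n. (x i)\<^sup>2) = 1 \<and> (\<forall>i>n. x i = 0)}"
      by (auto simp: \<phi>_def)
  qed
  have "\<psi> (\<phi> f) = f" if f: "f \<in> topspace ?X" for f
  proof -
    have f': "\<And>v. 0 \<le> f v" "\<And>v. v \<notin> B \<Longrightarrow> f v = 0" "\<exists>v\<in>B. f v = 0" "(\<Sum>v\<in>B. f v) = 1"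
      using f by (auto simp: topspace_realization_boundary_simp[OF fin])
    have r: "r f > 0" by (rule r_pos[OF f])
    have h: "h (\<phi> f) v = (f v - 1 / N) / r f" if "v \<in> B" for v
    proof (cases "v = b")
      case True
      have "(\<Sum>i\<le>n. \<phi> f i) = (\<Sum>i\<le>n. f (e i) - 1 / N) / r f"
        by (simp add: \<phi>_def sum_divide_distrib)
      also have "(\<Sum>i\<le>n. f (e i) - 1 / N) = 1 - f b - (real n + 1) / N"
        using f'(4) by (simp add: sum_B sum_subtractf add.commute)
      also have "\<dots> = - (f b - 1 / N)"
        using N by (simp add: field_simps N_def)
      finally show ?thesis using True by (simp add: h_def diff_divide_distrib)
    qed (use ed that in \<open>simp add: h_def \<phi>_def\<close>)
    \<comment> \<open>The minimum is attained where \<open>f\<close> vanishes; this is the place at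
      which lying on the boundary matters.\<close>
    have m: "m (\<phi> f) = - (1 / N) / r f"
      unfolding m_def
    proof (rule Min_eqI)
      show "- (1 / N) / r f \<in> h (\<phi> f) ` B"
        using f'(3) h by force
      fix y assume "y \<in> h (\<phi> f) ` B"
      then obtain v where "v \<in> B" "y = (f v - 1 / N) / r f" using h by auto
      then show "- (1 / N) / r f \<le> y"
        using f'(1)[of v] r divide_right_mono[of "- (1 / N)" "f v - 1 / N" "r f"] by simp
    qed (use fin in auto)
    have "s (\<phi> f) = 1 / r f"
      using N by (simp add: s_eq m)
    then have "\<psi> (\<phi> f) v = f v" for v
      using r f'(2) by (cases "v \<in> B") (simp_all add: \<psi>_def h m field_simps)
    then show ?thesis by auto
  qed
  moreover have "\<phi> (\<psi> x) = x" if x: "x \<in> topspace (nsphere n)" for x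
  proof -
    have s: "s x > 0" using m_neg[OF x] N by (simp add: s_eq mult_pos_neg)
    have *: "\<psi> x (e i) - 1 / N = x i / s x" if "i \<le> n" for i
    proof -
      have "m x / s x = - 1 / N" using m_neg[OF x] N by (simp add: s_eq field_simps)
      then show ?thesis
        using eB[OF that] by (simp add: \<psi>_def h_def de[OF that] diff_divide_distrib)
    qed
    have "r (\<psi> x) = sqrt ((\<Sum>i\<le>n. (x i)\<^sup>2) / (s x)\<^sup>2)"
      by (simp add: r_def * power_divide sum_divide_distrib)
    also have "\<dots> = 1 / s x"
      using x s by (simp add: S real_sqrt_divide)
    finally have "\<phi> (\<psi> x) i = x i" for i
      using s x by (cases "i \<le> n") (auto simp: \<phi>_def * S)
    then show ?thesis by auto
  qed
  ultimately have "homeomorphic_maps ?X (nsphere n) \<phi> \<psi>"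
    unfolding homeomorphic_maps_def using cont_\<phi> cont_\<psi> by blast
  then show ?thesis unfolding homeomorphic_space_def by blast
qed

lemma realization_boundary_simp_sphere:
  assumes fin: "finite B" and ne: "B \<noteq> {}"
  shows "realization (boundary_simp B) homotopy_equivalent_space int_sphere (int (card B) - 2)"
proof (cases "card B < 2")
  case True
  \<comment> \<open>With one vertex the only proper subset is the empty face, which carries no
    point, and the sphere of dimension -1 is empty as well.\<close>
  then have "card B = 1" using fin ne by (metis One_nat_def card_0_eq less_2_cases)
  then obtain b where "B = {b}" using card_1_singletonE by blast
  then have "topspace (realization (boundary_simp B)) = {}"
    using topspace_realization_boundary_simp[OF fin] by auto
  then have "realization (boundary_simp B) = trivial_topology"
    by (simp add: null_topspace_iff_trivial)
  then show ?thesis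
    using True
    by (auto simp: int_sphere_def homotopy_equivalent_space_def homotopic_on_emptyI)
next
  case False
  then have "card B = (card B - 2) + 2" by simp
  then have "realization (boundary_simp B) homeomorphic_space nsphere (card B - 2)"
    by (rule realization_boundary_simp_homeomorphic_nsphere[OF fin])
  moreover have "int_sphere (int (card B) - 2) = nsphere (card B - 2)"
    using False by (simp add: int_sphere_def nat_diff_distrib)
  ultimately show ?thesis
    by (simp add: homeomorphic_imp_homotopy_equivalent_space)
qed

section \<open>Contraction of alternating forms\<close>

text \<open>Contraction of a form \<open>g\<close>, a function on lists of arguments, with the covector \<open>\<phi>\<close>. For the
  constant covector \<open>1\<close> this is the simplicial coboundary; iterating it over several covectors
  gives their wedge product, a determinant.\<close>

primrec contract :: "('x \<Rightarrow> 'k::field) \<Rightarrow> ('x list \<Rightarrow> 'k) \<Rightarrow> 'x list \<Rightarrow> 'k" where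
  "contract \<phi> g [] = 0"
| "contract \<phi> g (x # xs) = \<phi> x * g xs - contract \<phi> (\<lambda>ys. g (x # ys)) xs"

section \<open>Linearity and nilpotency of contraction\<close>

lemma contract_zero [simp]: "contract \<phi> (\<lambda>_. 0) xs = 0"
  by (induction xs) auto

lemma contract_add: "contract \<phi> (\<lambda>ys. g ys + h ys) xs = contract \<phi> g xs + contract \<phi> h xs"
  by (induction xs arbitrary: g h) (auto simp: algebra_simps)

lemma contract_scale: "contract \<phi> (\<lambda>ys. a * g ys) xs = a * contract \<phi> g xs"
  by (induction xs arbitrary: g) (auto simp: algebra_simps)

lemma contract_minus: "contract \<phi> (\<lambda>ys. - g ys) xs = - contract \<phi> g xs"
  using contract_scale[of \<phi> "-1" g xs] by simp

lemma contract_diff: "contract \<phi> (\<lambda>ys. g ys - h ys) xs = contract \<phi> g xs - contract \<phi> h xs"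
  using contract_add[of \<phi> g "\<lambda>ys. - h ys" xs] by (simp add: contract_minus)

text \<open>Unfolding both contractions at the head \<open>x\<close> produces
  \<open>\<phi> x * contract \<phi> g xs\<close> twice with opposite signs; what remains is the
  claim for \<open>g\<close> with \<open>x\<close> as first argument. For \<open>\<phi> = 1\<close>
  this is the vanishing of the squared coboundary.\<close>

lemma contract_contract: "contract \<phi> (contract \<phi> g) xs = 0"
proof (induction xs arbitrary: g)
  case (Cons x xs)
  then show ?case
    by (simp add: contract_diff contract_scale)
qed simp

text \<open>This links the recursion, which suits list induction, with the alternating sum in
  \<open>coboundary\<close>.\<close>

lemma contract_eq_sum:
  "contract \<phi> g xs = (\<Sum>i<length xs. (-1) ^ i * \<phi> (xs ! i) * g (take i xs @ drop (Suc i) xs))"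
proof (induction xs arbitrary: g)
  case (Cons x xs)
  show ?case
    by (simp add: Cons sum.lessThan_Suc_shift sum_negf del: sum.lessThan_Suc)
qed simp

text \<open>Some summand of the alternating sum is nonzero. Supports and degrees of contractions are
  controlled through this.\<close>

lemma contract_nonzeroD:
  "contract \<phi> g xs \<noteq> 0 \<Longrightarrow> \<exists>ys x zs. xs = ys @ x # zs \<and> \<phi> x \<noteq> 0 \<and> g (ys @ zs) \<noteq> 0"
proof (induction xs arbitrary: g)
  case (Cons x xs)
  show ?case
  proof (cases "\<phi> x * g xs = 0")
    case True
    then have "contract \<phi> (\<lambda>ys. g (x # ys)) xs \<noteq> 0" using Cons.prems by auto
    from Cons.IH[OF this] obtain ys y zs
      where "xs = ys @ y # zs" "\<phi> y \<noteq> 0" "g (x # ys @ zs) \<noteq> 0" by auto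
    then show ?thesis by (intro exI[of _ "x # ys"]) auto
  next
    case False
    then show ?thesis by (intro exI[of _ "[]"]) auto
  qed
qed simp

text \<open>Only adjacent entries are exchanged, which survives prepending an argument and so fits
  the recursion of \<open>contract\<close>. \<open>skew_iff_swap\<close> recovers the condition on
  arbitrary swaps that \<open>cochains\<close> imposes.\<close>

definition skew :: "('x list \<Rightarrow> 'k::field) \<Rightarrow> bool" where
  "skew g \<longleftrightarrow> (\<forall>xs a b ys. g (xs @ a # b # ys) = - g (xs @ b # a # ys))"

lemma skewD: "skew g \<Longrightarrow> g (xs @ a # b # ys) = - g (xs @ b # a # ys)"
  unfolding skew_def by blast

lemma skewD0: "skew g \<Longrightarrow> g (a # b # ys) = - g (b # a # ys)"
  using skewD[of g "[]" a b ys] by simp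

lemma skew_Cons:
  assumes "skew g"
  shows "skew (\<lambda>ys. g (x # ys))"
  unfolding skew_def
proof (intro allI)
  fix xs a b ys
  show "g (x # xs @ a # b # ys) = - g (x # xs @ b # a # ys)"
    using skewD[OF assms, of "x # xs" a b ys] by simp
qed

lemma skew_contract:
  assumes "skew g"
  shows "skew (contract \<phi> g)"
proof -
  have "contract \<phi> g (xs @ a # b # ys) = - contract \<phi> g (xs @ b # a # ys)" for xs a b ys
    using assms
  proof (induction xs arbitrary: g)
    case Nil
    have "(\<lambda>zs. g (a # b # zs)) = (\<lambda>zs. - g (b # a # zs))"
      using skewD0[OF Nil] by blast
    then show ?case by (simp add: contract_minus algebra_simps)
  next
    case (Cons x xs)
    have "g (xs @ a # b # ys) = - g (xs @ b # a # ys)" by (rule skewD[OF Cons.prems])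
    then show ?case
      using Cons.IH[OF skew_Cons[OF Cons.prems, of x]] by simp
  qed
  then show ?thesis unfolding skew_def by blast
qed

lemma skew_move:
  assumes "skew g"
  shows "g (xs @ ys @ a # zs) = (-1) ^ length ys * g (xs @ a # ys @ zs)"
  using assms
proof (induction ys arbitrary: xs)
  case (Cons y ys)
  have "g (xs @ (y # ys) @ a # zs) = g ((xs @ [y]) @ ys @ a # zs)" by simp
  also have "\<dots> = (-1) ^ length ys * g (xs @ y # a # ys @ zs)"
    by (subst Cons.IH) (use Cons.prems in simp_all)
  also have "\<dots> = (-1) ^ length (y # ys) * g (xs @ a # (y # ys) @ zs)"
    by (subst skewD[OF Cons.prems]) simp
  finally show ?case .
qed simp

text \<open>Move \<open>b\<close> next to \<open>a\<close>, exchange the two, and move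
  \<open>a\<close> back to the old place of \<open>b\<close>. Both moves pass over
  \<open>ys\<close>, so their signs cancel.\<close>

lemma skew_swap:
  assumes "skew g"
  shows "g (xs @ a # ys @ b # zs) = - g (xs @ b # ys @ a # zs)"
proof -
  have "g (xs @ a # ys @ b # zs) = (-1) ^ length ys * g (xs @ a # b # ys @ zs)"
    using skew_move[OF assms, of "xs @ [a]" ys b zs] by simp
  also have "\<dots> = - ((-1) ^ length ys * g (xs @ b # a # ys @ zs))"
    by (subst skewD[OF assms]) simp
  also have "(-1) ^ length ys * g (xs @ b # a # ys @ zs) = g (xs @ b # ys @ a # zs)"
    using skew_move[OF assms, of "xs @ [b]" ys a zs] by simp
  finally show ?thesis .
qed

section \<open>Swaps at arbitrary positions and sorting by swaps\<close>

lemma swap_decomp: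
  assumes "i < j" "j < length xs"
  obtains ps qs rs where "xs = ps @ xs ! i # qs @ xs ! j # rs"
    "xs[i := xs ! j, j := xs ! i] = ps @ xs ! j # qs @ xs ! i # rs" "length ps = i"
proof -
  define ps qs rs where "ps = take i xs" and "qs = take (j - Suc i) (drop (Suc i) xs)"
    and "rs = drop (Suc j) xs"
  have l: "length ps = i" "length qs = j - Suc i"
    using assms by (auto simp: ps_def qs_def)
  have xs: "xs = ps @ xs ! i # qs @ xs ! j # rs"
  proof -
    have "drop (Suc i) xs = qs @ drop (j - Suc i) (drop (Suc i) xs)"
      by (simp add: qs_def del: drop_drop)
    also have "drop (j - Suc i) (drop (Suc i) xs) = xs ! j # rs"
      using assms by (simp add: rs_def Cons_nth_drop_Suc)
    finally show ?thesis
      using id_take_nth_drop[of i xs] assms by (simp add: ps_def)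
  qed
  have "(ps @ x # qs @ y # rs)[i := y, j := x] = ps @ y # qs @ x # rs" for x y
  proof -
    have "j = length (ps @ y # qs)" using l assms by simp
    then have "(ps @ y # qs @ y # rs)[j := x] = ps @ y # qs @ x # rs"
      by (metis append.assoc append_Cons list_update_length)
    moreover have "(ps @ x # qs @ y # rs)[i := y] = ps @ y # qs @ y # rs"
      using l(1) by (metis list_update_length)
    ultimately show ?thesis by simp
  qed
  then have "xs[i := xs ! j, j := xs ! i] = ps @ xs ! j # qs @ xs ! i # rs"
    using xs by metis
  with xs l(1) that show thesis by blast
qed

lemma skew_iff_swap:
  "skew g \<longleftrightarrow> (\<forall>xs i j. i < j \<and> j < length xs \<longrightarrow> g (xs[i := xs ! j, j := xs ! i]) = - g xs)"
proof
  assume g: "skew g"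
  show "\<forall>xs i j. i < j \<and> j < length xs \<longrightarrow> g (xs[i := xs ! j, j := xs ! i]) = - g xs"
  proof (intro allI impI, elim conjE)
    fix xs :: "'a list" and i j
    assume "i < j" "j < length xs"
    then obtain ps qs rs where "xs = ps @ xs ! i # qs @ xs ! j # rs"
      "xs[i := xs ! j, j := xs ! i] = ps @ xs ! j # qs @ xs ! i # rs"
      using swap_decomp by blast
    then show "g (xs[i := xs ! j, j := xs ! i]) = - g xs"
      using skew_swap[OF g, of ps "xs ! j" qs "xs ! i" rs] by metis
  qed
next
  assume R: "\<forall>xs i j. i < j \<and> j < length xs \<longrightarrow> g (xs[i := xs ! j, j := xs ! i]) = - g xs"
  show "skew g"
    unfolding skew_def
  proof (intro allI)
    fix xs ys :: "'a list" and a b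
    let ?l = "xs @ b # a # ys"
    have "g (?l[length xs := ?l ! Suc (length xs), Suc (length xs) := ?l ! length xs]) = - g ?l"
      by (rule R[rule_format]) auto
    then show "g (xs @ a # b # ys) = - g ?l"
      by (simp add: nth_append list_update_append)
  qed
qed

text \<open>The proof is selection sort.\<close>

lemma transposition_induct:
  assumes bs: "distinct bs" "P bs"
    and swap: "\<And>xs a ys b zs. P (xs @ b # ys @ a # zs) \<Longrightarrow> P (xs @ a # ys @ b # zs)"
    and xs: "distinct xs" "set xs = set bs"
  shows "P xs"
proof -
  have len: "length xs = length bs" if "distinct xs" "set xs = set bs" for xs :: "'a list"
    using that bs(1) distinct_card by metis
  \<comment> \<open>\<open>j\<close> counts the leading entries that already agree with
    \<open>bs\<close>. The induction descends from \<open>j = length bs\<close>, where the list is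
    \<open>bs\<close> itself.\<close>
  have "P xs" if "j \<le> length bs" "distinct xs" "set xs = set bs" "take j xs = take j bs" for j xs
    using that
  proof (induction j arbitrary: xs rule: inc_induct)
    case base
    then show ?case using len[of xs] bs by simp
  next
    case (step j)
    let ?y = "bs ! j"
    have lx: "length xs = length bs" using len[OF step.prems(1,2)] .
    have "?y \<in> set xs" using step.prems(2) step.hyps by simp
    then obtain p where p: "p < length xs" "xs ! p = ?y" by (auto simp: in_set_conv_nth)
    \<comment> \<open>The positions before \<open>j\<close> already hold other entries of the
      distinct list \<open>bs\<close>.\<close>
    have jp: "j \<le> p"
    proof (rule ccontr)
      assume "\<not> j \<le> p"
      then have "xs ! p = bs ! p" using step.prems(3) by (metis not_le nth_take)
      then show False
        using p \<open>\<not> j \<le> p\<close> step.hyps lx bs(1) by (simp add: nth_eq_iff_index_eq)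
    qed
    show ?case
    proof (cases "j = p")
      case True
      then have "take (Suc j) xs = take (Suc j) bs"
        using step.prems(3) p lx step.hyps by (simp add: take_Suc_conv_app_nth)
      then show ?thesis using step.IH step.prems(1,2) by blast
    next
      case False
      then have "j < p" using jp by simp
      then obtain ps a qs rs where d: "xs = ps @ a # qs @ ?y # rs" "length ps = j"
        using swap_decomp[of j p xs] p by metis
      let ?xs = "ps @ ?y # qs @ a # rs"
      have "distinct ?xs" "set ?xs = set bs"
        using step.prems(1,2) unfolding d(1) by auto
      moreover have "ps = take j bs" using d step.prems(3) by simp
      then have "take (Suc j) ?xs = take (Suc j) bs"
        using step.hyps d(2) by (simp add: take_Suc_conv_app_nth)
      ultimately have "P ?xs" using step.IH by blast
      then show ?thesis unfolding d(1) by (rule swap)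
    qed
  qed
  from this[of 0 xs] xs show ?thesis by simp
qed

text \<open>Vanishing is insensitive to sign, so the sign of the permutation never has to be
  computed.\<close>

lemma skew_zero_reorder:
  assumes "skew g" "distinct bs" "g bs = 0" "distinct xs" "set xs = set bs"
  shows "g xs = 0"
  using assms(2)
proof (rule transposition_induct[of bs "\<lambda>xs. g xs = 0"])
  show "g (us @ a # vs @ b # ws) = 0" if "g (us @ b # vs @ a # ws) = 0" for us a vs b ws
    using skew_swap[OF assms(1), of us a vs b ws] that by simp
qed (use assms in auto)

section \<open>Cohomology of cones and of simplex boundaries\<close>

interpretation fun_space: vector_space "fun_scale :: 'k::field \<Rightarrow> ('b \<Rightarrow> 'k) \<Rightarrow> 'b \<Rightarrow> 'k"
  by unfold_locales (auto simp: fun_scale_def algebra_simps)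

lemma quotient_vspace_zero:
  fixes W :: "('b \<Rightarrow> 'k::field) set"
  assumes W: "fun_space.subspace W" and V: "V \<subseteq> W" "V \<noteq> {}"
  shows "vs_iso (quotient_vspace V W) zero_vspace"
proof -
  have "{v + w | w. w \<in> W} = W" if "v \<in> V" for v
  proof (intro equalityI subsetI)
    fix x assume "x \<in> W"
    then have "x - v \<in> W" using fun_space.subspace_diff[OF W] that V by auto
    then show "x \<in> {v + w | w. w \<in> W}" by (intro CollectI exI[of _ "x - v"]) auto
  qed (use fun_space.subspace_add[OF W] that V in auto)
  then have "vs_carrier (quotient_vspace V W) = {W}"
    using V(2) by (auto simp: quotient_vspace_def)
  then show ?thesis
    unfolding vs_iso_def zero_vspace_def
    by (intro exI[of _ "\<lambda>_. ()"]) (auto simp: bij_betw_def)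
qed

text \<open>The cosets of the kernel of a functional are its level sets, and \<open>e\<close> makes
  every level occur. Coordinates from the field are provided so that two lines can be matched by
  \<open>vs_iso_lines\<close>. Linearity of \<open>L\<close> is asked on \<open>V\<close> alone,
  since the functional used for the exterior power is linear only on finitely supported
  functions.\<close>

lemma quotient_vspace_line:
  fixes V W :: "('b \<Rightarrow> 'k::field) set"
  assumes V: "fun_space.subspace V" and W: "W = {v \<in> V. L v = 0}"
    and add: "\<And>x y. x \<in> V \<Longrightarrow> y \<in> V \<Longrightarrow> L (x + y) = L x + L y"
    and scale: "\<And>a x. x \<in> V \<Longrightarrow> L (fun_scale a x) = a * L x"
    and e: "e \<in> V" "L e = 1"
  shows "\<exists>S. bij_betw S (UNIV :: 'k set) (vs_carrier (quotient_vspace V W)) \<and>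
    (\<forall>a b. vs_add (quotient_vspace V W) (S a) (S b) = S (a + b)) \<and>
    (\<forall>c a. vs_scale (quotient_vspace V W) c (S a) = S (c * a))"
proof -
  note Vadd = fun_space.subspace_add[OF V] and Vscale = fun_space.subspace_scale[OF V]
    and Vdiff = fun_space.subspace_diff[OF V]
  have diff: "L (x - y) = L x - L y" if "x \<in> V" "y \<in> V" for x y
    using add[OF Vdiff[OF that] that(2)] by simp
  define S where "S a = {v \<in> V. L v = a}" for a
  have coset: "{v + w | w. w \<in> W} = S (L v)" if v: "v \<in> V" for v
  proof (intro equalityI subsetI)
    fix x assume "x \<in> S (L v)"
    then have "x = v + (x - v)" "x - v \<in> W" using v Vdiff by (auto simp: S_def W diff)
    then show "x \<in> {v + w | w. w \<in> W}" by blast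
  qed (use v Vadd add in \<open>auto simp: S_def W\<close>)
  have in_S: "fun_scale a e \<in> S a" for a
    using e by (simp add: S_def Vscale scale)
  have "vs_carrier (quotient_vspace V W) = range S"
  proof -
    have "a \<in> L ` V" for a
      by (rule image_eqI[of _ _ "fun_scale a e"]) (use in_S[of a] in \<open>simp_all add: S_def\<close>)
    then have "L ` V = UNIV" by auto
    moreover have "{{v + w | w. w \<in> W} | v. v \<in> V} = (\<lambda>v. S (L v)) ` V"
      unfolding Setcompr_eq_image using coset by (intro image_cong) auto
    ultimately show ?thesis
      by (simp add: quotient_vspace_def image_image[of S L V, symmetric])
  qed
  moreover have "inj S"
  proof (rule injI)
    fix x y assume "S x = S y"
    then have "fun_scale x e \<in> S y" using in_S[of x] by simp
    then show "x = y" using in_S[of x] by (simp add: S_def)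
  qed
  ultimately have "bij_betw S UNIV (vs_carrier (quotient_vspace V W))"
    by (simp add: bij_betw_def)
  moreover have "vs_add (quotient_vspace V W) (S a) (S b) = S (a + b)" for a b
  proof -
    have "\<exists>x y. v = x + y \<and> x \<in> S a \<and> y \<in> S b" if v: "v \<in> S (a + b)" for v
      using v in_S[of a] by (intro exI[of _ "fun_scale a e"] exI[of _ "v - fun_scale a e"])
        (auto simp: S_def diff Vdiff)
    then show ?thesis
      unfolding quotient_vspace_def by (auto simp: S_def Vadd add)
  qed
  moreover have "vs_scale (quotient_vspace V W) c (S a) = S (c * a)" for c a
  proof -
    \<comment> \<open>The summand from \<open>W\<close> absorbs the difference to
      \<open>fun_scale c (fun_scale a e)\<close>; for \<open>c = 0\<close> it supplies the entire
      level set.\<close>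
    have "\<exists>x w. v = fun_scale c x + w \<and> x \<in> S a \<and> w \<in> W" if v: "v \<in> S (c * a)" for v
      using v in_S[of a]
      by (intro exI[of _ "fun_scale a e"] exI[of _ "v - fun_scale c (fun_scale a e)"])
        (auto simp: S_def W diff Vdiff Vscale scale simp del: fun_space.scale_scale)
    then show ?thesis
      unfolding quotient_vspace_def by (auto simp: S_def W Vadd Vscale add scale)
  qed
  ultimately show ?thesis by blast
qed

lemma vs_iso_lines:
  fixes S :: "'k::field \<Rightarrow> 'v" and S' :: "'k \<Rightarrow> 'w"
  assumes S: "bij_betw S UNIV (vs_carrier V)"
      "\<And>a b. vs_add V (S a) (S b) = S (a + b)" "\<And>c a. vs_scale V c (S a) = S (c * a)"
    and S': "bij_betw S' UNIV (vs_carrier W)"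
      "\<And>a b. vs_add W (S' a) (S' b) = S' (a + b)" "\<And>c a. vs_scale W c (S' a) = S' (c * a)"
  shows "vs_iso V W"
proof -
  have inv: "inv S (S a) = a" for a using S(1) by (simp add: bij_betw_def)
  have V: "vs_carrier V = range S" using S(1) by (simp add: bij_betw_def)
  have "bij_betw (S' \<circ> inv S) (vs_carrier V) (vs_carrier W)"
    by (rule bij_betw_trans[OF bij_betw_inv_into[OF S(1)] S'(1)])
  then show ?thesis
    unfolding vs_iso_def
    by (intro exI[of _ "S' \<circ> inv S"]) (auto simp: V S(2,3) S'(2,3) inv)
qed

section \<open>Cochains and the cone operator\<close>

lemma mem_cochains:
  "c \<in> cochains K r \<longleftrightarrow>
    (\<forall>xs. c xs \<noteq> 0 \<longrightarrow> distinct xs \<and> set xs \<in> K \<and> int (length xs) = r + 1) \<and> skew c"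
  by (simp add: cochains_def skew_iff_swap)

abbreviation \<delta> :: "('a list \<Rightarrow> 'k::field) \<Rightarrow> 'a list \<Rightarrow> 'k" where
  "\<delta> \<equiv> contract (\<lambda>_. 1)"

lemma coboundary_eq:
  "coboundary K c = (\<lambda>xs. if distinct xs \<and> set xs \<in> K then \<delta> c xs else 0)"
  by (simp add: coboundary_def contract_eq_sum cong: if_cong)

lemma skew_restrict:
  fixes g :: "'a list \<Rightarrow> 'k::field"
  assumes "skew g"
  shows "skew (\<lambda>xs. if distinct xs \<and> set xs \<in> K then g xs else 0)"
  unfolding skew_def
proof (intro allI)
  fix xs ys :: "'a list" and a b
  have eq: "set (xs @ a # b # ys) = set (xs @ b # a # ys)"
    "distinct (xs @ a # b # ys) = distinct (xs @ b # a # ys)" by auto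
  then show "(if distinct (xs @ a # b # ys) \<and> set (xs @ a # b # ys) \<in> K then g (xs @ a # b # ys) else 0) =
    - (if distinct (xs @ b # a # ys) \<and> set (xs @ b # a # ys) \<in> K then g (xs @ b # a # ys) else 0)"
    unfolding eq skewD[OF assms, of xs a b ys] by (simp del: distinct.simps distinct_append set_append)
qed

lemma coboundary_in_cochains:
  assumes "c \<in> cochains K r"
  shows "coboundary K c \<in> cochains K (r + 1)"
proof -
  have "int (length xs) = r + 2" if "\<delta> c xs \<noteq> 0" for xs
    using contract_nonzeroD[OF that] assms by (fastforce simp: mem_cochains)
  then show ?thesis
    unfolding mem_cochains coboundary_eq
    using assms by (auto intro!: skew_restrict skew_contract simp: mem_cochains split: if_splits)
qed

lemma subspace_cochains: "fun_space.subspace (cochains K r :: ('a list \<Rightarrow> 'k::field) set)"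
proof (rule fun_space.subspaceI)
  fix c d :: "'a list \<Rightarrow> 'k" assume "c \<in> cochains K r" "d \<in> cochains K r"
  then show "c + d \<in> cochains K r"
    unfolding cochains_def by (simp add: plus_fun_def) (metis add_0)
qed (auto simp: cochains_def fun_scale_def)

lemma coboundary_add: "coboundary K (c + d) = coboundary K c + coboundary K d"
  by (auto simp: coboundary_eq plus_fun_def contract_add)

lemma coboundary_scale: "coboundary K (fun_scale a c) = fun_scale a (coboundary K c)"
  by (auto simp: coboundary_eq fun_scale_def contract_scale)

lemma coboundary_zero: "coboundary K 0 = 0"
  by (auto simp: coboundary_eq zero_fun_def)

lemma subspace_coboundaries:
  "fun_space.subspace (coboundaries K r :: ('a list \<Rightarrow> 'k::field) set)"
proof -
  note sub = subspace_cochains[of K "r - 1"]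
  show ?thesis
    unfolding coboundaries_def
  proof (rule fun_space.subspaceI)
    show "0 \<in> coboundary K ` cochains K (r - 1)"
      using fun_space.subspace_0[OF sub] coboundary_zero by force
  next
    fix x y :: "'a list \<Rightarrow> 'k"
    assume "x \<in> coboundary K ` cochains K (r - 1)" "y \<in> coboundary K ` cochains K (r - 1)"
    then obtain c d where "c \<in> cochains K (r - 1)" "d \<in> cochains K (r - 1)"
      "x + y = coboundary K (c + d)" by (auto simp: coboundary_add)
    then show "x + y \<in> coboundary K ` cochains K (r - 1)"
      using fun_space.subspace_add[OF sub] by blast
  next
    fix a and x :: "'a list \<Rightarrow> 'k"
    assume "x \<in> coboundary K ` cochains K (r - 1)"
    then obtain c where "c \<in> cochains K (r - 1)" "fun_scale a x = coboundary K (fun_scale a c)"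
      by (auto simp: coboundary_scale)
    then show "fun_scale a x \<in> coboundary K ` cochains K (r - 1)"
      using fun_space.subspace_scale[OF sub] by blast
  qed
qed

text \<open>The primitive is \<open>c\<close> with \<open>v\<close> prepended. The hypothesis uses
  \<open>\<delta>\<close> rather than \<open>coboundary K\<close>, so it also has content when
  \<open>v # xs\<close> is not a face; this case occurs in the top degree of a simplex
  boundary.\<close>

lemma cochain_in_coboundaries:
  fixes c :: "'a list \<Rightarrow> 'k::field"
  assumes down: "\<And>F G. F \<in> K \<Longrightarrow> G \<subseteq> F \<Longrightarrow> G \<in> K" and c: "c \<in> cochains K r"
    and closed: "\<And>xs. distinct xs \<Longrightarrow> set xs \<in> K \<Longrightarrow> int (length xs) = r + 1 \<Longrightarrow> v \<notin> set xs
      \<Longrightarrow> \<delta> c (v # xs) = 0"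
  shows "c \<in> coboundaries K r"
proof -
  have supp: "\<And>xs. c xs \<noteq> 0 \<Longrightarrow> distinct xs \<and> set xs \<in> K \<and> int (length xs) = r + 1"
    and skew: "skew c" using c by (auto simp: mem_cochains)
  define h where "h = (\<lambda>xs. c (v # xs))"
  have skew_h: "skew h" unfolding h_def by (rule skew_Cons[OF skew])
  have h_supp: "distinct xs \<and> v \<notin> set xs \<and> set xs \<in> K \<and> int (length xs) = r" if "h xs \<noteq> 0" for xs
    using supp[of "v # xs"] that down[of "set (v # xs)" "set xs"] by (auto simp: h_def)
  have "h \<in> cochains K (r - 1)"
    using h_supp skew_h by (simp add: mem_cochains)
  moreover have "coboundary K h = c"
  proof
    fix xs
    show "coboundary K h xs = c xs"
    proof (cases "distinct xs \<and> set xs \<in> K")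
      case False
      then show ?thesis using supp[of xs] by (auto simp: coboundary_eq)
    next
      case True
      have "\<delta> h xs = c xs"
      proof (cases "v \<in> set xs")
        case v: False
        show ?thesis
        proof (cases "int (length xs) = r + 1")
          case l: True
          \<comment> \<open>This is the homotopy formula, read off from the recursion of
            \<open>contract\<close> at the head \<open>v\<close>.\<close>
          have "\<delta> c (v # xs) = c xs - \<delta> h xs" by (simp add: h_def)
          then show ?thesis using closed[of xs] True v l by simp
        next
          case l: False
          have "\<delta> h xs = 0"
          proof (rule ccontr)
            assume "\<delta> h xs \<noteq> 0"
            then obtain ys x zs where "xs = ys @ x # zs" "h (ys @ zs) \<noteq> 0"
              using contract_nonzeroD by blast
            then show False using h_supp[of "ys @ zs"] l by simp
          qed
          moreover have "c xs = 0" using supp l by blast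
          ultimately show ?thesis by simp
        qed
      next
        case v: True
        then obtain ys zs where xs: "xs = ys @ v # zs" by (meson split_list)
        \<comment> \<open>A list that contains \<open>v\<close> twice is no simplex. So with
          \<open>v\<close> moved to the front only the term deleting \<open>v\<close> survives, and
          moving it there changes both sides by the same sign.\<close>
        have "h (v # us) = 0" for us
          using h_supp[of "v # us"] by auto
        then have "\<delta> h (v # ys @ zs) = h (ys @ zs)" by simp
        then have "\<delta> h (v # ys @ zs) = c (v # ys @ zs)" by (simp add: h_def)
        then show ?thesis
          using skew_move[OF skew, of "[]" ys v zs] skew_move[OF skew_contract[OF skew_h], of "\<lambda>_. 1" "[]" ys v zs]
          by (simp add: xs)
      qed
      then show ?thesis using True by (simp add: coboundary_eq)
    qed
  qed
  ultimately show ?thesis unfolding coboundaries_def by blast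
qed

text \<open>The apex condition concerns only faces with \<open>r + 1\<close> vertices. Thus it
  covers cones in all degrees and simplex boundaries in all degrees but one.\<close>

lemma reduced_cohomology_zero:
  fixes k :: "'k::field itself"
  assumes down: "\<And>F G. F \<in> K \<Longrightarrow> G \<subseteq> F \<Longrightarrow> G \<in> K"
    and apex: "\<And>F. F \<in> K \<Longrightarrow> finite F \<Longrightarrow> int (card F) = r + 1 \<Longrightarrow> insert v F \<in> K"
  shows "vs_iso (reduced_cohomology k K r) zero_vspace"
proof -
  have "cocycles K r \<subseteq> (coboundaries K r :: ('a list \<Rightarrow> 'k) set)"
  proof
    fix c :: "'a list \<Rightarrow> 'k" assume c: "c \<in> cocycles K r"
    show "c \<in> coboundaries K r"
    proof (rule cochain_in_coboundaries[OF down])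
      fix xs :: "'a list"
      assume xs: "distinct xs" "set xs \<in> K" "int (length xs) = r + 1" "v \<notin> set xs"
      then have "insert v (set xs) \<in> K" using apex distinct_card by fastforce
      moreover have "coboundary K c (v # xs) = 0"
        using c by (simp add: cocycles_def)
      ultimately show "\<delta> c (v # xs) = 0" using xs by (simp add: coboundary_eq)
    qed (use c in \<open>auto simp: cocycles_def\<close>)
  qed
  moreover have "(0 :: 'a list \<Rightarrow> 'k) \<in> cocycles K r"
    using fun_space.subspace_0[OF subspace_cochains] by (simp add: cocycles_def coboundary_zero)
  ultimately show ?thesis
    unfolding reduced_cohomology_def by (intro quotient_vspace_zero subspace_coboundaries) auto
qed

section \<open>Determinants as iterated contractions, and the cocycle of a simplex boundary\<close>

primrec wedge :: "('x \<Rightarrow> 'k::field) list \<Rightarrow> 'x list \<Rightarrow> 'k" where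
  "wedge [] = (\<lambda>xs. if xs = [] then 1 else 0)"
| "wedge (\<phi> # \<Phi>) = contract \<phi> (wedge \<Phi>)"

lemma skew_wedge: "skew (wedge \<Phi>)"
  by (induction \<Phi>) (auto simp: skew_contract, simp add: skew_def)

lemma contract_eq_0: "(\<And>x. x \<in> set xs \<Longrightarrow> \<phi> x = 0) \<Longrightarrow> contract \<phi> g xs = 0"
  by (rule ccontr) (drule contract_nonzeroD, auto)

text \<open>\<open>wedge\<close> is the Laplace expansion of a determinant along its first covector,
  here for the identity matrix: that covector kills all arguments but the first.\<close>

lemma wedge_dual_basis:
  assumes "distinct bs" "\<And>b c. \<phi> b (\<epsilon> c) = (if b = c then 1 else 0)"
  shows "wedge (map \<phi> bs) (map \<epsilon> bs) = 1"
  using assms(1)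
proof (induction bs)
  case (Cons b bs)
  have "contract (\<phi> b) (\<lambda>ys. wedge (map \<phi> bs) (\<epsilon> b # ys)) (map \<epsilon> bs) = 0"
    by (rule contract_eq_0) (use Cons.prems in \<open>auto simp: assms(2)\<close>)
  then show ?case using Cons by (simp add: assms(2))
qed simp

lemma wedge_single_nonzeroD:
  "wedge (map single bs) xs \<noteq> (0::'k::field) \<Longrightarrow> length xs = length bs \<and> set xs = set bs"
proof (induction bs arbitrary: xs)
  case (Cons b bs)
  then have "contract (single b) (wedge (map single bs)) xs \<noteq> (0::'k)" by simp
  from contract_nonzeroD[OF this] obtain ys x zs
    where "xs = ys @ x # zs" "single b x \<noteq> (0::'k)" "wedge (map single bs) (ys @ zs) \<noteq> (0::'k)"
    by auto
  moreover from this(2) have "x = b" by (auto simp: single_def split: if_splits)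
  ultimately show ?case using Cons.IH[of "ys @ zs"] by auto
qed (auto split: if_splits)

lemma cohomology_boundary_simp_line:
  fixes B :: "'a set"
  assumes fin: "finite B" and ne: "B \<noteq> {}"
  defines "K \<equiv> boundary_simp B" and "r \<equiv> int (card B) - 2"
  shows "\<exists>S. bij_betw S UNIV (vs_carrier (reduced_cohomology (k :: 'k::field itself) K r)) \<and>
    (\<forall>a b. vs_add (reduced_cohomology k K r) (S a) (S b) = S (a + b)) \<and>
    (\<forall>c a. vs_scale (reduced_cohomology k K r) c (S a) = S (c * a))"
proof -
  obtain bs0 where bs0: "set bs0 = B" "distinct bs0" using finite_distinct_list[OF fin] by auto
  with ne obtain v bs where bs: "bs0 = v # bs" by (cases bs0) auto
  then have B: "distinct (v # bs)" "set (v # bs) = B" using bs0 by auto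
  have card: "card B = length bs + 1" using distinct_card[OF B(1)] B(2) by simp
  have small: "length xs \<le> length bs" if "distinct xs" "set xs \<in> K" for xs
    using psubset_card_mono[OF fin, of "set xs"] that distinct_card[of xs] card
    by (auto simp: K_def boundary_simp_def)
  let ?L = "\<lambda>c :: 'a list \<Rightarrow> 'k. \<delta> c (v # bs)"
  \<comment> \<open>Degree \<open>r\<close> is the top one: a nonzero coboundary would need a face
    with all \<open>card B\<close> vertices.\<close>
  have Z: "cocycles K r = (cochains K r :: ('a list \<Rightarrow> 'k) set)"
  proof -
    have "coboundary K c xs = 0" if c: "c \<in> cochains K r" for c :: "'a list \<Rightarrow> 'k" and xs
    proof (rule ccontr)
      assume "coboundary K c xs \<noteq> 0"
      then have "distinct xs \<and> set xs \<in> K \<and> int (length xs) = r + 1 + 1"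
        using coboundary_in_cochains[OF c] by (auto simp: mem_cochains)
      then show False using small[of xs] card by (simp add: r_def)
    qed
    then show ?thesis by (auto simp: cocycles_def)
  qed
  have W: "coboundaries K r = {c \<in> cocycles K r. ?L c = 0}"
  proof (intro equalityI subsetI)
    fix c :: "'a list \<Rightarrow> 'k" assume "c \<in> coboundaries K r"
    then obtain h where h: "h \<in> cochains K (r - 1)" "c = coboundary K h"
      by (auto simp: coboundaries_def)
    then have "c \<in> cochains K r" using coboundary_in_cochains[of h K "r - 1"] by simp
    \<comment> \<open>The facets of the missing face are faces of \<open>K\<close>, so there
      \<open>coboundary K h\<close> agrees with \<open>\<delta> h\<close>, and contracting twice
      gives 0.\<close>
    moreover have "?L c = ?L (\<delta> h)"
      unfolding contract_eq_sum[of _ _ "v # bs"]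
    proof (rule sum.cong)
      fix i assume i: "i \<in> {..<length (v # bs)}"
      let ?xs = "take i (v # bs) @ drop (Suc i) (v # bs)"
      have eq: "v # bs = take i (v # bs) @ (v # bs) ! i # drop (Suc i) (v # bs)"
        using i by (intro id_take_nth_drop) auto
      have "distinct (take i (v # bs) @ (v # bs) ! i # drop (Suc i) (v # bs))"
        "set (take i (v # bs) @ (v # bs) ! i # drop (Suc i) (v # bs)) = B"
        using B unfolding eq[symmetric] by auto
      then have "distinct ?xs" "set ?xs \<subset> B" by auto
      then have "c ?xs = \<delta> h ?xs"
        unfolding h(2) coboundary_eq by (simp add: K_def boundary_simp_def)
      then show "(- 1) ^ i * 1 * c ?xs = (- 1) ^ i * 1 * \<delta> h ?xs" by simp
    qed simp
    ultimately show "c \<in> {c \<in> cocycles K r. ?L c = 0}"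
      by (simp add: Z contract_contract del: contract.simps)
  next
    fix c :: "'a list \<Rightarrow> 'k" assume "c \<in> {c \<in> cocycles K r. ?L c = 0}"
    then have c: "c \<in> cochains K r" "?L c = 0" by (auto simp: Z)
    show "c \<in> coboundaries K r"
    proof (rule cochain_in_coboundaries[OF _ c(1)])
      fix xs assume xs: "distinct xs" "set xs \<in> K" "int (length xs) = r + 1" "v \<notin> set xs"
      \<comment> \<open>Counting shows that \<open>v # xs\<close> uses up all of \<open>B\<close>,
        so it is a reordering of \<open>v # bs\<close>, where \<open>\<delta> c\<close>
        vanishes.\<close>
      have "set (v # xs) \<subseteq> B" using xs B by (auto simp: K_def boundary_simp_def)
      moreover have "card (set (v # xs)) = card B"
        using xs distinct_card[of "v # xs"] by (simp add: r_def)
      ultimately have "set (v # xs) = set (v # bs)"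
        using card_subset_eq[OF fin] B(2) by metis
      moreover have "skew (\<delta> c)"
        using c by (intro skew_contract) (simp add: mem_cochains)
      ultimately show "\<delta> c (v # xs) = 0"
        using skew_zero_reorder[of "\<delta> c" "v # bs" "v # xs"] B(1) c(2) xs by (simp del: contract.simps)
    qed (auto simp: K_def boundary_simp_def)
  qed
  \<comment> \<open>The signed indicator of the facet opposite \<open>v\<close>. The other facets
    contain \<open>v\<close>, so only the first term of \<open>?L e\<close> is nonzero.\<close>
  define e :: "'a list \<Rightarrow> 'k" where "e = wedge (map single bs)"
  have e_supp: "length xs = length bs \<and> set xs = set bs" if "e xs \<noteq> 0" for xs
    using wedge_single_nonzeroD that unfolding e_def by blast
  have "e \<in> cochains K r"
  proof -
    have "distinct xs \<and> set xs \<in> K \<and> int (length xs) = r + 1" if "e xs \<noteq> 0" for xs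
    proof -
      have "distinct xs"
        using e_supp[OF that] B(1) distinct_card[of bs] by (intro card_distinct) auto
      moreover have "set bs \<in> K" using B by (auto simp: K_def boundary_simp_def)
      ultimately show ?thesis using e_supp[OF that] card by (simp add: r_def)
    qed
    then show ?thesis using skew_wedge by (auto simp: mem_cochains e_def)
  qed
  moreover have "?L e = 1"
  proof -
    have "e (v # ys) = 0" for ys using e_supp[of "v # ys"] B(1) by auto
    moreover have "wedge (map single bs) (map (\<lambda>x. x) bs) = (1::'k)"
      by (rule wedge_dual_basis) (use B(1) in \<open>auto simp: single_def\<close>)
    then have "e bs = 1" by (simp add: e_def)
    ultimately show ?thesis by simp
  qed
  ultimately show ?thesis
    unfolding reduced_cohomology_def
    by (intro quotient_vspace_line[where L = ?L and e = e])
      (auto simp: W Z plus_fun_def fun_scale_def contract_add contract_scale subspace_cochains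
        simp del: contract.simps)
qed

section \<open>The top exterior power\<close>

text \<open>No length is prescribed, so the property passes to a form whose first argument is
  fixed.\<close>

definition multilinear :: "(('b \<Rightarrow> 'k::field) list \<Rightarrow> 'k) \<Rightarrow> bool" where
  "multilinear g \<longleftrightarrow>
    (\<forall>xs u v ys. g (xs @ (u + v) # ys) = g (xs @ u # ys) + g (xs @ v # ys)) \<and>
    (\<forall>xs a u ys. g (xs @ fun_scale a u # ys) = a * g (xs @ u # ys))"

lemma multilinear_add: "multilinear g \<Longrightarrow> g (xs @ (u + v) # ys) = g (xs @ u # ys) + g (xs @ v # ys)"
  and multilinear_scale: "multilinear g \<Longrightarrow> g (xs @ fun_scale a u # ys) = a * g (xs @ u # ys)"
  unfolding multilinear_def by blast+

lemma multilinear_Cons: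
  assumes "multilinear g"
  shows "multilinear (\<lambda>ys. g (x # ys))"
proof -
  have "g (x # xs @ (u + v) # ys) = g (x # xs @ u # ys) + g (x # xs @ v # ys)" for xs u v ys
    using multilinear_add[OF assms, of "x # xs" u v ys] by simp
  moreover have "g (x # xs @ fun_scale a u # ys) = a * g (x # xs @ u # ys)" for xs a u ys
    using multilinear_scale[OF assms, of "x # xs" a u ys] by simp
  ultimately show ?thesis unfolding multilinear_def by blast
qed

lemma multilinear_contract:
  assumes g: "multilinear g"
    and \<phi>: "\<And>u v. \<phi> (u + v) = \<phi> u + \<phi> v" "\<And>a u. \<phi> (fun_scale a u) = a * \<phi> u"
  shows "multilinear (contract \<phi> g)"
proof -
  have "contract \<phi> g (xs @ (u + v) # ys) = contract \<phi> g (xs @ u # ys) + contract \<phi> g (xs @ v # ys)"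
    for xs u v ys
    using g
  proof (induction xs arbitrary: g)
    case Nil
    have eq: "(\<lambda>zs. g ((u + v) # zs)) = (\<lambda>zs. g (u # zs) + g (v # zs))"
      using multilinear_add[OF Nil, of "[]" u v] by auto
    show ?case
      unfolding append_Nil contract.simps eq contract_add \<phi>(1) by (simp add: algebra_simps)
  next
    case (Cons x xs)
    show ?case
      unfolding append_Cons contract.simps Cons.IH[OF multilinear_Cons[OF Cons.prems, of x]]
        multilinear_add[OF Cons.prems, of xs u v ys]
      by (simp add: algebra_simps)
  qed
  moreover have "contract \<phi> g (xs @ fun_scale a u # ys) = a * contract \<phi> g (xs @ u # ys)" for xs a u ys
    using g
  proof (induction xs arbitrary: g)
    case Nil
    have eq: "(\<lambda>zs. g (fun_scale a u # zs)) = (\<lambda>zs. a * g (u # zs))"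
      using multilinear_scale[OF Nil, of "[]" a u] by auto
    show ?case
      unfolding append_Nil contract.simps eq contract_scale \<phi>(2) by (simp add: algebra_simps)
  next
    case (Cons x xs)
    show ?case
      unfolding append_Cons contract.simps Cons.IH[OF multilinear_Cons[OF Cons.prems, of x]]
        multilinear_scale[OF Cons.prems, of xs a u ys]
      by (simp add: algebra_simps)
  qed
  ultimately show ?thesis unfolding multilinear_def by blast
qed

text \<open>In characteristic 2 skewness gives no vanishing on repeated arguments, so this is proved
  on its own: the two terms that delete one copy of \<open>a\<close> cancel.\<close>

lemma contract_repeated:
  assumes "\<And>xs a ys. g (xs @ a # a # ys) = 0"
  shows "contract \<phi> g (xs @ a # a # ys) = 0"
  using assms
proof (induction xs arbitrary: g)
  case Nil
  have "(\<lambda>zs. g (a # a # zs)) = (\<lambda>_. 0)" using Nil[of "[]"] by simp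
  then show ?case by simp
next
  case (Cons x xs)
  have "contract \<phi> (\<lambda>zs. g (x # zs)) (xs @ a # a # ys) = 0"
    by (rule Cons.IH) (use Cons.prems[of "x # _"] in simp)
  then show ?case using Cons.prems[of xs a ys] by simp
qed

lemma wedge_adjacent: "wedge \<Phi> (xs @ a # a # ys) = 0"
  by (induction \<Phi> arbitrary: xs a ys) (simp_all add: contract_repeated)

lemma wedge_repeated: "wedge \<Phi> (ps @ a # qs @ a # rs) = 0"
  using skew_move[OF skew_wedge, of \<Phi> "ps @ [a]" qs a rs] wedge_adjacent[of \<Phi> ps a "qs @ rs"]
  by simp

section \<open>Tuples modulo the alternating relations\<close>

lemma alternating_relationsE:
  assumes "x \<in> alternating_relations n V" and V: "fun_space.subspace V"
  obtains (add) ps u v rs where "u \<in> V" "v \<in> V" "set ps \<subseteq> V" "set rs \<subseteq> V" "length ps + length rs + 1 = n"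
      "x = single (ps @ (u + v) # rs) - single (ps @ u # rs) - single (ps @ v # rs)"
  | (scale) ps a u rs where "u \<in> V" "set ps \<subseteq> V" "set rs \<subseteq> V" "length ps + length rs + 1 = n"
      "x = single (ps @ fun_scale a u # rs) - fun_scale a (single (ps @ u # rs))"
  | (repeated) ps u qs rs where "u \<in> V" "set ps \<subseteq> V" "set qs \<subseteq> V" "set rs \<subseteq> V"
      "length ps + length qs + length rs + 2 = n" "x = single (ps @ u # qs @ u # rs)"
proof -
  have upd: "xs[i := y] = take i xs @ y # drop (Suc i) xs" if "xs \<in> tuples n V" "i < n" for xs i y
    using that by (simp add: tuples_def upd_conv_take_nth_drop)
  have parts: "set (take i xs) \<subseteq> V" "set (drop (Suc i) xs) \<subseteq> V"
    "length (take i xs) + length (drop (Suc i) xs) + 1 = n"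
    if "xs \<in> tuples n V" "i < n" for xs i
    using that set_take_subset[of i xs] set_drop_subset[of "Suc i" xs] by (auto simp: tuples_def)
  consider (1) xs i u v where "xs \<in> tuples n V" "i < n" "u \<in> V" "v \<in> V"
      "x = single (xs[i := u + v]) - single (xs[i := u]) - single (xs[i := v])"
    | (2) xs i a u where "xs \<in> tuples n V" "i < n" "u \<in> V"
      "x = single (xs[i := fun_scale a u]) - fun_scale a (single (xs[i := u]))"
    | (3) xs i j where "xs \<in> tuples n V" "i < j" "j < n" "xs ! i = xs ! j" "x = single xs"
    using assms(1) unfolding alternating_relations_def by blast
  then show thesis
  proof cases
    case 1
    show thesis
      by (rule add[OF 1(3,4) parts[OF 1(1,2)]]) (use 1 upd in simp)
  next
    case 2
    show thesis
      by (rule scale[OF 2(3) parts[OF 2(1,2)]]) (use 2 upd in simp)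
  next
    case 3
    then have l: "length xs = n" "set xs \<subseteq> V" by (auto simp: tuples_def)
    then obtain ps qs rs where d: "xs = ps @ xs ! i # qs @ xs ! j # rs"
      using swap_decomp[of i j xs] 3 by metis
    define u where "u = xs ! j"
    have "xs = ps @ u # qs @ u # rs" using d 3(4) by (simp add: u_def)
    then show thesis using repeated[of u ps qs rs] l 3(5) by auto
  qed
qed

lemma alternating_relations_add:
  assumes "u \<in> V" "v \<in> V" "set ps \<subseteq> V" "set rs \<subseteq> V" "length ps + length rs + 1 = n"
  shows "single (ps @ (u + v) # rs) - single (ps @ u # rs) - single (ps @ v # rs)
    \<in> alternating_relations n V"
proof -
  have "ps @ u # rs \<in> tuples n V" "length ps < n" using assms by (auto simp: tuples_def)
  moreover have "single (ps @ (u + v) # rs) - single (ps @ u # rs) - single (ps @ v # rs) =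
    single ((ps @ u # rs)[length ps := u + v]) - single ((ps @ u # rs)[length ps := u])
      - single ((ps @ u # rs)[length ps := v])" by simp
  ultimately show ?thesis using assms(1,2) unfolding alternating_relations_def by blast
qed

lemma alternating_relations_scale:
  assumes "u \<in> V" "set ps \<subseteq> V" "set rs \<subseteq> V" "length ps + length rs + 1 = n"
  shows "single (ps @ fun_scale a u # rs) - fun_scale a (single (ps @ u # rs))
    \<in> alternating_relations n V"
proof -
  have "ps @ u # rs \<in> tuples n V" "length ps < n" using assms by (auto simp: tuples_def)
  moreover have "single (ps @ fun_scale a u # rs) - fun_scale a (single (ps @ u # rs)) =
    single ((ps @ u # rs)[length ps := fun_scale a u])
      - fun_scale a (single ((ps @ u # rs)[length ps := u]))" by simp
  ultimately show ?thesis using assms(1) unfolding alternating_relations_def by blast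
qed

lemma alternating_relations_repeated:
  assumes "u \<in> V" "set ps \<subseteq> V" "set qs \<subseteq> V" "set rs \<subseteq> V"
    "length ps + length qs + length rs + 2 = n"
  shows "single (ps @ u # qs @ u # rs) \<in> alternating_relations n V"
proof -
  let ?xs = "ps @ u # qs @ u # rs" and ?j = "length ps + length qs + 1"
  have "?xs ! ?j = (u # qs @ u # rs) ! (length qs + 1)"
    using nth_append_length_plus[of ps "u # qs @ u # rs" "length qs + 1"] by (simp add: add.assoc)
  then have "?xs \<in> tuples n V" "length ps < ?j" "?j < n" "?xs ! length ps = ?xs ! ?j"
    using assms by (auto simp: tuples_def)
  then show ?thesis unfolding alternating_relations_def by blast
qed

text \<open>Modulo the relations a tuple depends linearly on each slot. This reduces membership in
  \<open>M\<close> to basis vectors, one slot at a time.\<close>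

lemma single_slot_subspace:
  fixes V :: "('b \<Rightarrow> 'k::field) set"
  assumes V: "fun_space.subspace V" and M: "fun_space.subspace M" "alternating_relations n V \<subseteq> M"
    and l: "set ps \<subseteq> V" "set rs \<subseteq> V" "length ps + length rs + 1 = n"
  shows "fun_space.subspace {u \<in> V. single (ps @ u # rs) \<in> M}"
proof (rule fun_space.subspaceI)
  have zero: "(0 :: 'b \<Rightarrow> 'k) \<in> V" by (rule fun_space.subspace_0[OF V])
  \<comment> \<open>With scalar 0 the subtracted term disappears, and the relation itself is the
    tuple with zero in the slot.\<close>
  have "single (ps @ fun_scale 0 0 # rs) - fun_scale 0 (single (ps @ 0 # rs)) \<in> M"
    using alternating_relations_scale[OF zero l] M(2) by blast
  then show "0 \<in> {u \<in> V. single (ps @ u # rs) \<in> M}"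
    using zero by simp
next
  fix u v assume u: "u \<in> {u \<in> V. single (ps @ u # rs) \<in> M}" and v: "v \<in> {u \<in> V. single (ps @ u # rs) \<in> M}"
  then have "single (ps @ (u + v) # rs) - single (ps @ u # rs) - single (ps @ v # rs) \<in> M"
    using alternating_relations_add[OF _ _ l, of u v] M(2) by blast
  then have "single (ps @ (u + v) # rs) - single (ps @ u # rs) - single (ps @ v # rs)
      + single (ps @ v # rs) + single (ps @ u # rs) \<in> M"
    using u v fun_space.subspace_add[OF M(1)] by blast
  then have "single (ps @ (u + v) # rs) \<in> M" by simp
  then show "u + v \<in> {u \<in> V. single (ps @ u # rs) \<in> M}"
    using u v fun_space.subspace_add[OF V] by blast
next
  fix a u assume u: "u \<in> {u \<in> V. single (ps @ u # rs) \<in> M}"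
  then have "single (ps @ fun_scale a u # rs) - fun_scale a (single (ps @ u # rs)) \<in> M"
    using alternating_relations_scale[OF _ l, of u a] M(2) by blast
  then have "single (ps @ fun_scale a u # rs) - fun_scale a (single (ps @ u # rs))
      + fun_scale a (single (ps @ u # rs)) \<in> M"
    using u fun_space.subspace_add[OF M(1)] fun_space.subspace_scale[OF M(1)] by blast
  then have "single (ps @ fun_scale a u # rs) \<in> M" by simp
  then show "fun_scale a u \<in> {u \<in> V. single (ps @ u # rs) \<in> M}"
    using u fun_space.subspace_scale[OF V] by blast
qed

text \<open>Polarization: expand the tuple with \<open>a + b\<close> in both slots; the three tuples
  with equal slots are relations, which leaves the sum of the two mixed ones.\<close>

lemma single_swap:
  assumes V: "fun_space.subspace V" and M: "fun_space.subspace M" "alternating_relations n V \<subseteq> M"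
    and l: "a \<in> V" "b \<in> V" "set ps \<subseteq> V" "set qs \<subseteq> V" "set rs \<subseteq> V"
      "length ps + length qs + length rs + 2 = n"
    and ba: "single (ps @ b # qs @ a # rs) \<in> M"
  shows "single (ps @ a # qs @ b # rs) \<in> M"
proof -
  let ?f = "\<lambda>x y. single (ps @ x # qs @ y # rs)"
  have ab: "a + b \<in> V" using l(1,2) by (rule fun_space.subspace_add[OF V])
  have rep: "?f x x \<in> M" if "x \<in> V" for x
    using alternating_relations_repeated[OF that l(3-6)] M(2) by blast
  have 1: "?f (a + b) (a + b) - ?f a (a + b) - ?f b (a + b) \<in> M"
    using alternating_relations_add[OF l(1,2,3), of "qs @ (a + b) # rs" n] l ab M(2) by auto
  have 2: "?f x (a + b) - ?f x a - ?f x b \<in> M" if "x \<in> V" for x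
    using alternating_relations_add[OF l(1,2), of "ps @ x # qs" rs n] l that M(2) by auto
  have "?f a b = ?f (a + b) (a + b) - (?f (a + b) (a + b) - ?f a (a + b) - ?f b (a + b))
      - (?f a (a + b) - ?f a a - ?f a b) - (?f b (a + b) - ?f b a - ?f b b)
      - ?f a a - ?f b b - ?f b a" by simp
  also have "\<dots> \<in> M"
    by (intro fun_space.subspace_diff[OF M(1)] rep 1 2 l ab ba)
  finally show ?thesis .
qed

lemma span_single: "finite B \<Longrightarrow> free_vspace k B \<subseteq> fun_space.span (single ` B)"
proof
  fix u assume B: "finite B" and u: "u \<in> free_vspace k B"
  have "u = (\<Sum>b\<in>B. fun_scale (u b) (single b))"
  proof
    fix x
    have "(\<Sum>b\<in>B. fun_scale (u b) (single b)) x = (\<Sum>b\<in>B. if x = b then u b else 0)"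
      by (induction B rule: infinite_finite_induct) (auto simp: fun_scale_def single_def)
    also have "\<dots> = u x" using B u by (simp add: free_vspace_def)
    finally show "u x = (\<Sum>b\<in>B. fun_scale (u b) (single b)) x" by simp
  qed
  also have "\<dots> \<in> fun_space.span (single ` B)"
    by (intro fun_space.span_sum fun_space.span_scale fun_space.span_base) auto
  finally show "u \<in> fun_space.span (single ` B)" .
qed

lemma subspace_free_vspace: "fun_space.subspace (free_vspace k B)"
  by (rule fun_space.subspaceI) (auto simp: free_vspace_def fun_scale_def)

text \<open>Expanding every entry in the standard basis leaves tuples of basis vectors. Those with a
  repetition are relations, the others are sorted into the order of \<open>bs\<close> by
  swaps.\<close>

lemma single_tuple_in:
  fixes k :: "'k::field itself" and M :: "(('a \<Rightarrow> 'k) list \<Rightarrow> 'k) set"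
  defines "V \<equiv> free_vspace k"
  assumes bs: "distinct bs" "set bs = B"
    and M: "fun_space.subspace M" "alternating_relations (card B) (V B) \<subseteq> M"
      "single (map single bs) \<in> M"
    and xs: "xs \<in> tuples (card B) (V B)"
  shows "single xs \<in> M"
proof -
  have fin: "finite B" using bs by auto
  have V: "fun_space.subspace (V B)" unfolding V_def by (rule subspace_free_vspace)
  have single_V: "single b \<in> V B" if "b \<in> B" for b
    using that by (auto simp: V_def free_vspace_def single_def)
  have card: "length bs = card B" using bs distinct_card by metis
  have base: "single (map single ys) \<in> M" if ys: "set ys \<subseteq> B" "length ys = card B" for ys
  proof (cases "distinct ys")
    case True
    let ?P = "\<lambda>ys. set ys \<subseteq> B \<and> length ys = card B \<and> single (map single ys) \<in> M"
    have "set ys = set bs"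
      using True ys bs(2) card_subset_eq[OF fin] distinct_card by metis
    with bs(1) _ _ True have "?P ys"
    proof (rule transposition_induct[where P = ?P])
      show "?P bs" using bs card M(3) by auto
      fix ps a qs b rs assume P: "?P (ps @ b # qs @ a # rs)"
      have "single (map single ps @ single a # map single qs @ single b # map single rs) \<in> M"
        by (rule single_swap[OF V M(1,2)]) (use P single_V in auto)
      then show "?P (ps @ a # qs @ b # rs)" using P by auto
    qed
    then show ?thesis by blast
  next
    case False
    then obtain ps qs rs y where d: "ys = ps @ [y] @ qs @ [y] @ rs"
      using not_distinct_decomp by blast
    have "single (map single ps @ single y # map single qs @ single y # map single rs)
        \<in> alternating_relations (card B) (V B)"
      by (rule alternating_relations_repeated) (use d ys single_V in auto)
    then show ?thesis using M(2) d by auto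
  qed
  \<comment> \<open>The entries in \<open>fs\<close> are still arbitrary and those from
    \<open>ys\<close> are already basis vectors; the induction converts the last entry of
    \<open>fs\<close> next.\<close>
  have "single (fs @ map single ys) \<in> M"
    if "set fs \<subseteq> V B" "set ys \<subseteq> B" "length fs + length ys = card B" for fs ys
    using that
  proof (induction fs arbitrary: ys rule: rev_induct)
    case Nil
    then show ?case using base by simp
  next
    case (snoc f fs)
    let ?S = "{u \<in> V B. single (fs @ u # map single ys) \<in> M}"
    have "fun_space.subspace ?S"
      by (rule single_slot_subspace[OF V M(1,2)]) (use snoc.prems single_V in auto)
    moreover have "single ` B \<subseteq> ?S"
    proof
      fix u assume "u \<in> (single :: 'a \<Rightarrow> 'a \<Rightarrow> 'k) ` B"
      then obtain b where b: "b \<in> B" "u = single b" by auto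
      have "single (fs @ map single (b # ys)) \<in> M"
        by (rule snoc.IH) (use snoc.prems b in auto)
      then show "u \<in> ?S" using b single_V by simp
    qed
    ultimately have "fun_space.span (single ` B) \<subseteq> ?S"
      by (rule fun_space.span_minimal[rotated])
    moreover have "f \<in> fun_space.span (single ` B)"
      using span_single[OF fin, of k] snoc.prems by (auto simp: V_def)
    ultimately show ?case by auto
  qed
  from this[of xs "[]"] xs show ?thesis by (auto simp: tuples_def)
qed

lemma det_space_line:
  fixes k :: "'k::field itself" and B :: "'a set"
  assumes fin: "finite B"
  shows "\<exists>S. bij_betw S UNIV (vs_carrier (det_space k B)) \<and>
    (\<forall>a b. vs_add (det_space k B) (S a) (S b) = S (a + b)) \<and>
    (\<forall>c a. vs_scale (det_space k B) c (S a) = S (c * a))"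
proof -
  obtain bs where bs: "distinct bs" "set bs = B" using finite_distinct_list[OF fin] by auto
  let ?n = "card B" and ?V = "free_vspace k B"
  let ?T = "fun_space.span (single ` tuples ?n ?V) :: (('a \<Rightarrow> 'k) list \<Rightarrow> 'k) set"
  let ?R = "alternating_relations ?n ?V"
  have len: "length bs = ?n" using bs distinct_card by metis
  \<comment> \<open>The determinant, with evaluation at the points of \<open>bs\<close> as
    covectors. They are dual to the unit vectors in \<open>es\<close>.\<close>
  define D :: "('a \<Rightarrow> 'k) list \<Rightarrow> 'k" where "D = wedge (map (\<lambda>b f. f b) bs)"
  define es :: "('a \<Rightarrow> 'k) list" where "es = map single bs"
  have D_es: "D es = 1"
    unfolding D_def es_def by (rule wedge_dual_basis[OF bs(1)]) (simp add: single_def)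
  have D_multilinear: "multilinear D"
  proof -
    have "multilinear (wedge (map (\<lambda>b f. f b) bs) :: ('a \<Rightarrow> 'k) list \<Rightarrow> 'k)" for bs :: "'a list"
    proof (induction bs)
      case (Cons b bs)
      then show ?case by (simp add: multilinear_contract fun_scale_def)
    qed (simp add: multilinear_def)
    then show ?thesis by (simp add: D_def)
  qed
  \<comment> \<open>The linear extension of \<open>D\<close> to formal combinations of tuples. On
    infinite support the sum takes its default value 0, so linearity is claimed within
    \<open>FS\<close> only.\<close>
  define L where "L \<phi> = (\<Sum>xs | \<phi> xs \<noteq> 0. \<phi> xs * D xs)" for \<phi> :: "('a \<Rightarrow> 'k) list \<Rightarrow> 'k"
  define FS where "FS = {\<phi> :: ('a \<Rightarrow> 'k) list \<Rightarrow> 'k. finite {xs. \<phi> xs \<noteq> 0}}"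
  have L_eq: "L \<phi> = (\<Sum>xs\<in>S. \<phi> xs * D xs)" if "finite S" "{xs. \<phi> xs \<noteq> 0} \<subseteq> S" for \<phi> S
    unfolding L_def by (rule sum.mono_neutral_left) (use that in auto)
  have L_add: "L (\<phi> + \<psi>) = L \<phi> + L \<psi>" if "\<phi> \<in> FS" "\<psi> \<in> FS" for \<phi> \<psi>
  proof -
    let ?S = "{xs. \<phi> xs \<noteq> 0} \<union> {xs. \<psi> xs \<noteq> 0}"
    have fin: "finite ?S" using that by (simp add: FS_def)
    have "L (\<phi> + \<psi>) = (\<Sum>xs\<in>?S. (\<phi> + \<psi>) xs * D xs)" by (rule L_eq[OF fin]) auto
    also have "\<dots> = (\<Sum>xs\<in>?S. \<phi> xs * D xs) + (\<Sum>xs\<in>?S. \<psi> xs * D xs)"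
      by (simp add: algebra_simps sum.distrib)
    also have "\<dots> = L \<phi> + L \<psi>" using L_eq[OF fin, of \<phi>] L_eq[OF fin, of \<psi>] by auto
    finally show ?thesis .
  qed
  have L_scale: "L (fun_scale a \<phi>) = a * L \<phi>" if "\<phi> \<in> FS" for a \<phi>
  proof -
    have fin: "finite {xs. \<phi> xs \<noteq> 0}" using that by (simp add: FS_def)
    have "L (fun_scale a \<phi>) = (\<Sum>xs | \<phi> xs \<noteq> 0. fun_scale a \<phi> xs * D xs)"
      by (rule L_eq[OF fin]) (auto simp: fun_scale_def)
    then show ?thesis by (simp add: L_def fun_scale_def sum_distrib_left mult.assoc)
  qed
  have L_single: "L (single xs) = D xs" for xs
    using L_eq[of "{xs}" "single xs"] by (simp add: single_def)
  have FS: "fun_space.subspace FS"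
  proof (rule fun_space.subspaceI)
    fix \<phi> \<psi> assume "\<phi> \<in> FS" "\<psi> \<in> FS"
    then have "finite ({xs. \<phi> xs \<noteq> 0} \<union> {xs. \<psi> xs \<noteq> 0})" by (simp add: FS_def)
    then show "\<phi> + \<psi> \<in> FS"
      unfolding FS_def mem_Collect_eq by (rule rev_finite_subset) auto
  next
    fix a \<phi> assume "\<phi> \<in> FS"
    then show "fun_scale a \<phi> \<in> FS"
      unfolding FS_def by (auto simp: fun_scale_def elim: rev_finite_subset)
  qed (simp add: FS_def)
  have single_FS: "single xs \<in> FS" for xs by (simp add: FS_def single_def)
  have L_diff: "L (\<phi> - \<psi>) = L \<phi> - L \<psi>" if "\<phi> \<in> FS" "\<psi> \<in> FS" for \<phi> \<psi>
    using L_add[OF fun_space.subspace_diff[OF FS that] that(2)] by simp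
  have T_FS: "?T \<subseteq> FS" by (rule fun_space.span_minimal[OF _ FS]) (auto simp: single_FS)
  have T: "fun_space.subspace ?T" by (rule fun_space.subspace_span)
  have V: "fun_space.subspace ?V" by (rule subspace_free_vspace)
  have single_T: "single xs \<in> ?T" if "set xs \<subseteq> ?V" "length xs = ?n" for xs
    using that by (intro fun_space.span_base imageI) (simp add: tuples_def)
  let ?K = "{\<phi> \<in> ?T. L \<phi> = 0}"
  have K: "fun_space.subspace ?K"
    using fun_space.subspace_add[OF T] fun_space.subspace_scale[OF T] fun_space.subspace_0[OF T] T_FS
    by (intro fun_space.subspaceI) (auto simp: L_add L_scale subset_iff, simp add: L_def)
  have "?R \<subseteq> ?K"
  proof
    fix x assume "x \<in> ?R"
    from this V show "x \<in> ?K"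
    proof (cases rule: alternating_relationsE)
      case (add ps u v rs)
      have "u + v \<in> ?V" using fun_space.subspace_add[OF V] add by blast
      then have "x \<in> ?T" unfolding add(6)
        by (intro fun_space.subspace_diff[OF T] single_T) (use add(1-5) in auto)
      moreover have "L x = 0"
        unfolding add(6) using multilinear_add[OF D_multilinear, of ps u v rs]
        by (simp add: L_diff L_single single_FS fun_space.subspace_diff[OF FS])
      ultimately show ?thesis by simp
    next
      case (scale ps a u rs)
      have "fun_scale a u \<in> ?V" using fun_space.subspace_scale[OF V] scale by blast
      then have "x \<in> ?T" unfolding scale(5)
        by (intro fun_space.subspace_diff[OF T] fun_space.subspace_scale[OF T] single_T)
          (use scale(1-4) in auto)
      moreover have "L x = 0"
        unfolding scale(5) using multilinear_scale[OF D_multilinear, of ps a u rs]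
        by (simp add: L_diff L_scale L_single single_FS fun_space.subspace_scale[OF FS])
      ultimately show ?thesis by simp
    next
      case (repeated ps u qs rs)
      then have "x \<in> ?T" using single_T by simp
      moreover have "L x = 0"
        using repeated(6) wedge_repeated by (simp add: L_single D_def)
      ultimately show ?thesis by simp
    qed
  qed
  then have R_K: "fun_space.span ?R \<subseteq> ?K" using K by (rule fun_space.span_minimal)
  have es_T: "single es \<in> ?T"
    by (rule single_T) (use bs len in \<open>auto simp: es_def free_vspace_def single_def\<close>)
  have "?K \<subseteq> fun_space.span ?R"
  proof
    fix \<phi> assume "\<phi> \<in> ?K"
    \<comment> \<open>All tuples lie in the span of the relations and \<open>single es\<close>, so
      \<open>\<phi>\<close> is a multiple of \<open>single es\<close> up to relations; applying
      \<open>L\<close> shows that the factor is 0.\<close>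
    let ?M = "fun_space.span (insert (single es) ?R)"
    have "single ` tuples ?n ?V \<subseteq> ?M"
    proof (rule image_subsetI)
      fix xs :: "('a \<Rightarrow> 'k) list" assume "xs \<in> tuples ?n ?V"
      then show "single xs \<in> ?M"
      proof (rule single_tuple_in[OF bs, rotated 3])
        show "?R \<subseteq> ?M"
          using fun_space.span_superset[of "insert (single es) ?R"] by blast
        show "single (map single bs) \<in> ?M"
          unfolding es_def by (rule fun_space.span_base) simp
      qed (rule fun_space.subspace_span)
    qed
    then have "?T \<subseteq> ?M"
      by (rule fun_space.span_minimal) (rule fun_space.subspace_span)
    then have "\<phi> \<in> ?M" using \<open>\<phi> \<in> ?K\<close> by blast
    then obtain a where a: "\<phi> - fun_scale a (single es) \<in> fun_space.span ?R"
      unfolding fun_space.span_breakdown_eq by blast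
    then have "L (\<phi> - fun_scale a (single es)) = 0" using R_K by blast
    moreover have "\<phi> \<in> FS" using \<open>\<phi> \<in> ?K\<close> T_FS by blast
    ultimately have "a = 0"
      using \<open>\<phi> \<in> ?K\<close> by (simp add: L_diff L_scale L_single single_FS fun_space.subspace_scale[OF FS] D_es)
    then show "\<phi> \<in> fun_space.span ?R" using a by simp
  qed
  then have W: "fun_space.span ?R = {\<phi> \<in> ?T. L \<phi> = 0}" using R_K by blast
  show ?thesis
    unfolding det_space_def exterior_power_def
  proof (rule quotient_vspace_line[OF T W])
    show "L (x + y) = L x + L y" if "x \<in> ?T" "y \<in> ?T" for x y
      using that T_FS by (intro L_add) blast+
    show "L (fun_scale a x) = a * L x" if "x \<in> ?T" for a x
      using that T_FS by (intro L_scale) blast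
    show "L (single es) = 1" by (simp add: L_single D_es)
  qed (rule es_T)
qed

section \<open>Homotopy type and cohomology\<close>

lemma N_minus_down: "F \<in> N_minus P T C \<Longrightarrow> G \<subseteq> F \<Longrightarrow> G \<in> N_minus P T C"
  unfolding N_minus_def by blast

lemma N_minus_nonempty:
  assumes "finite T" "C \<in> upset_intervals P T" "C \<noteq> T"
  shows "N_minus P T C \<noteq> {}"
proof -
  obtain U where "U \<in> maximal_upset_intervals P T" "C \<subseteq> U"
    using ex_maximal_upset_interval[OF assms] by blast
  then have "{} \<in> N_minus P T C" unfolding N_minus_def by blast
  then show ?thesis by blast
qed

lemma boundary_simp_cohomology:
  fixes k :: "'k::field itself" and B :: "'a set"
  assumes fin: "finite B" and ne: "B \<noteq> {}"
  shows "if r = int (card B) - 2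
    then vs_iso (reduced_cohomology k (boundary_simp B) r) (det_space k B)
    else vs_iso (reduced_cohomology k (boundary_simp B) r) zero_vspace"
proof (cases "r = int (card B) - 2")
  case True
  obtain S :: "'k \<Rightarrow> ('a list \<Rightarrow> 'k) set"
    where S: "bij_betw S UNIV (vs_carrier (reduced_cohomology k (boundary_simp B) r))"
      "\<And>a b. vs_add (reduced_cohomology k (boundary_simp B) r) (S a) (S b) = S (a + b)"
      "\<And>c a. vs_scale (reduced_cohomology k (boundary_simp B) r) c (S a) = S (c * a)"
    unfolding True using cohomology_boundary_simp_line[OF fin ne, of k] by blast
  obtain S' :: "'k \<Rightarrow> (('a \<Rightarrow> 'k) list \<Rightarrow> 'k) set"
    where S': "bij_betw S' UNIV (vs_carrier (det_space k B))"
      "\<And>a b. vs_add (det_space k B) (S' a) (S' b) = S' (a + b)"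
      "\<And>c a. vs_scale (det_space k B) c (S' a) = S' (c * a)"
    using det_space_line[OF fin, of k] by blast
  show ?thesis
    using vs_iso_lines[OF S S'] True by simp
next
  case False
  obtain v where v: "v \<in> B" using ne by blast
  \<comment> \<open>Adding \<open>v\<close> can complete a face to \<open>B\<close> only if the face
    has \<open>card B - 1\<close> vertices, that is, in the excluded degree.\<close>
  have "insert v F \<in> boundary_simp B"
    if F: "F \<in> boundary_simp B" "finite F" "int (card F) = r + 1" for F
  proof -
    have FB: "F \<subset> B" using F(1) by (simp add: boundary_simp_def)
    have "insert v F \<noteq> B"
    proof
      assume eq: "insert v F = B"
      then have "v \<notin> F" using FB by auto
      then have "card B = card F + 1" using F(2) eq by auto
      then show False using F(3) False by simp
    qed
    then show ?thesis using FB v by (auto simp: boundary_simp_def)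
  qed
  then have "vs_iso (reduced_cohomology k (boundary_simp B) r) zero_vspace"
    by (intro reduced_cohomology_zero[where v = v]) (auto simp: boundary_simp_def)
  then show ?thesis using False by simp
qed

theorem proposition5p9:
  fixes k :: "'k::field itself" and P T C :: "'a::order set"
  assumes "finite P" and "poset_connected P"
    and "T \<in> Intervals P" and "C \<in> upset_intervals P T" and "C \<noteq> T"
  shows "(if (T, C) \<in> Upsilon_minus P
          then realization (N_minus P T C)
                 homotopy_equivalent_space realization (boundary_simp (minimals (T - C))) \<and>
               realization (boundary_simp (minimals (T - C)))
                 homotopy_equivalent_space int_sphere (int (omega_minus T C) - 2)
          else realization (N_minus P T C) homotopy_equivalent_space point_space) \<and>
         (\<forall>r::int.
            if (T, C) \<in> Upsilon_minus P \<and> r = int (omega_minus T C) - 2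
            then vs_iso (reduced_cohomology k (N_minus P T C) r) (det_space k (minimals (T - C)))
            else vs_iso (reduced_cohomology k (N_minus P T C) r) zero_vspace)"
proof -
  let ?N = "N_minus P T C" and ?B = "minimals (T - C)"
  have T: "finite T" using assms(1,3) by (auto simp: Intervals_def intro: finite_subset)
  have ne: "?N \<noteq> {}" by (rule N_minus_nonempty[OF T assms(4,5)])
  show ?thesis
  proof (cases "(T, C) \<in> Upsilon_minus P")
    case True
    then have ext: "extremal_lower_boundary T C" by (simp add: Upsilon_minus_def)
    have N: "?N = boundary_simp ?B" by (rule N_minus_extremal[OF T assms(3,4) ext])
    have \<omega>: "omega_minus T C = card ?B"
      using ext by (simp add: omega_minus_def extremal_lower_boundary_def)
    have fin: "finite ?B" using T by (simp add: minimals_def)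
    \<comment> \<open>The complex has at least the empty face, whereas the empty set has no proper
      subset.\<close>
    have "?B \<noteq> {}" using ne N by (auto simp: boundary_simp_def)
    then show ?thesis
      using realization_boundary_simp_sphere[OF fin] boundary_simp_cohomology[OF fin, of _ k] True
      by (simp add: N \<omega> homotopy_equivalent_space_refl)
  next
    case False
    then have "\<not> extremal_lower_boundary T C"
      using assms(3,4) by (simp add: Upsilon_minus_def)
    then obtain v where v: "\<And>F. F \<in> ?N \<Longrightarrow> insert v F \<in> ?N"
      using N_minus_cone[OF T assms(3,4,5)] by blast
    have fin: "finite (lower_boundary T C)" using T by (simp add: lower_boundary_def)
    have "?N \<subseteq> Pow (lower_boundary T C)" by (auto simp: N_minus_def)
    then have "realization ?N homotopy_equivalent_space point_space"
      by (rule cone_realization_contractible[OF fin _ ne N_minus_down v])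
    moreover have "vs_iso (reduced_cohomology k ?N r) zero_vspace" for r
      by (rule reduced_cohomology_zero[OF N_minus_down v])
    ultimately show ?thesis using False by simp
  qed
qed

end
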